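(* Let $M$ be a Riemannian manifold and $f:M\to\mathbb{R}$ a differentiable function such that $\operatorname{grad} f$ is $L$-Lipschitz continuous for some $L\ge 0$. Assume that $f$ has a minimizer $q\in M$, with $f^*=f(q)$, and that there exists $\mu>0$ such that $$f(x)-f^*\le\frac1\mu\|\operatorname{grad} f(x)\|^2\qquad\text{for all }x\in M.$$ Let $\eta>0$, let $x_0\in M$ with $\operatorname{grad} f(x_0)\ne0$, and let $\{x_k\}_{k\ge0}$ be generated by MAdaGrad from $x_0$ with parameter $\eta$. Set $$\alpha_{\min}=\left(L+\frac{2(f(x_0)-f^* )}{\eta^2}+\frac{\eta^2L^3}{\|\operatorname{grad} f(x_0)\|^2}\right)^{-1},$$ and for each $\epsilon>0$ define $T_f(\epsilon)=\inf\{k\in\mathbb{N}: f(x_k)-f^*\le\epsilon\}$. If $\|\operatorname{grad} f(x_0)\|\ge\eta L$, then $$T_f(\epsilon)<1+\frac{\left|\log\left(\left[f(x_0)-f^*+\frac{\eta^4L^3}{2\|\operatorname{grad} f(x_0)\|^2}\right]\epsilon^{-1}\right)\right|}{\left|\log\left(1-\frac{\mu\alpha_{\min}}{2}\right)\right|}.$$ Otherwise, $$T_f(\epsilon)<1+\left[\frac{\eta^2L^2}{\mu}\epsilon^{-1}+1\right]\log\left(\frac{\eta^2L^2}{\|\operatorname{grad} f(x_0)\|^2}\right)+\frac{\left|\log\left(\left[f(x_0)-f^*+\frac{\eta^4L^3}{2\|\operatorname{grad} f(x_0)\|^2}\right]\epsilon^{-1}\right)\right|}{\left|\log\left(1-\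frac{\mu\alpha_{\min}}{2}\right)\right|}.$$
   Context: All manifolds are connected, finite dimensional and complete Riemannian manifolds; $\|\cdot\|$ is the norm of the Riemannian metric on tangent spaces, $d$ the Riemannian distance, $\operatorname{grad} f$ the Riemannian gradient, $\exp_p:T_pM\to M$ the exponential map; $\mathbb{N}$ includes $0$. Given $L\ge 0$, $\operatorname{grad} f$ is $L$-Lipschitz continuous if for any $p,q\in M$ and any geodesic segment $\gamma$ joining $p$ to $q$, $\|P_{\gamma,p,q}\operatorname{grad} f(p)-\operatorname{grad} f(q)\|\le L\,d(p,q)$, where $P_{\gamma,p,q}$ is the parallel transport along $\gamma$ from $p$ to $q$. MAdaGrad (Algorithm 1): given $x_0\in M$ and $\eta>0$, set $\beta_0=0$; for $k=0,1,2,\dots$, stop if $\operatorname{grad} f(x_k)=0$, and otherwise set $$\beta_{k+1}=\beta_k+\|\operatorname{grad} f(x_k)\|^2,\qquad \alpha_k=\frac{\eta}{\sqrt{\beta_{k+1}}},\qquad x_{k+1}=\exp_{x_k}\left(-\alpha_k\operatorname{grad} f(x_k)\right).$$ Convention: when $\operatorname{grad} f(x_0)\ne 0$, these three formulas make sense for all $k\ge 0$, and if the algorithm stops at some iterate the sequences are continued by the same formulas (so $x_k$, $\beta_k$ and $\alpha_k$ stay constant from then on). *)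

theory Defs
  imports "HOL-Analysis.Analysis"
begin

section \<open>Smooth maps between open subsets of Euclidean spaces\<close>

primrec Ck_on ::
  "nat \<Rightarrow> ('a::euclidean_space \<Rightarrow> 'b::real_normed_vector) \<Rightarrow> 'a set \<Rightarrow> bool" where
  "Ck_on 0 f S \<longleftrightarrow> continuous_on S f"
| "Ck_on (Suc n) f S \<longleftrightarrow>
     (\<forall>x\<in>S. f differentiable (at x)) \<and> (\<forall>v. Ck_on n (\<lambda>x. frechet_derivative f (at x) v) S)"

definition smooth_on :: "('a::euclidean_space \<Rightarrow> 'b::real_normed_vector) \<Rightarrow> 'a set \<Rightarrow> bool" where
  "smooth_on f S \<longleftrightarrow> (\<forall>n. Ck_on n f S)"


section \<open>Riemannian manifolds\<close>

text \<open>
  The manifold is the whole type \<open>'m\<close>, modelled on the Euclidean space \<open>'e\<close>. A chart is a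
  pair of its domain and its coordinate map; the values of the map outside the domain are irrelevant.

  Every point \<open>p\<close> has a preferred chart \<open>chart_at A p\<close> of the atlas, and a tangent vector at
  \<open>p\<close> is represented by its components in that chart, so that each \<open>T\<^sub>pM\<close> is a copy of \<open>'e\<close>. The
  preferred chart varies with \<open>p\<close> without any continuity, so derivatives of vector fields, and
  smoothness of the metric, are always expressed by the components in one fixed chart.
\<close>

type_synonym ('m, 'e) chart = "'m set \<times> ('m \<Rightarrow> 'e)"
type_synonym ('m, 'e) metric = "'m \<Rightarrow> 'e \<Rightarrow> 'e \<Rightarrow> real"

definition chart_inv :: "('m, 'e) chart \<Rightarrow> 'e \<Rightarrow> 'm" where
  "chart_inv c = inv_into (fst c) (snd c)"

definition chart_at :: "('m, 'e) chart set \<Rightarrow> 'm \<Rightarrow> ('m, 'e) chart" where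
  "chart_at A p = (SOME c. c \<in> A \<and> p \<in> fst c)"

definition smooth_atlas ::
  "('m::topological_space, 'e::euclidean_space) chart set \<Rightarrow> bool" where
  "smooth_atlas A \<longleftrightarrow>
     (\<forall>c\<in>A. open (fst c) \<and> open (snd c ` fst c) \<and>
        homeomorphism (fst c) (snd c ` fst c) (snd c) (chart_inv c)) \<and>
     (\<Union>c\<in>A. fst c) = UNIV \<and>
     (\<forall>c\<in>A. \<forall>c'\<in>A. smooth_on (snd c' \<circ> chart_inv c) (snd c ` (fst c \<inter> fst c')))"

text \<open>The transformation of the components of a tangent vector at \<open>p\<close> from chart \<open>c\<close> to \<open>c'\<close>.\<close>

definition change_comps ::
  "('m, 'e::euclidean_space) chart \<Rightarrow> ('m, 'e) chart \<Rightarrow> 'm \<Rightarrow> 'e \<Rightarrow> 'e" where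
  "change_comps c c' p u = frechet_derivative (snd c' \<circ> chart_inv c) (at (snd c p)) u"

definition comps ::
  "('m, 'e::euclidean_space) chart set \<Rightarrow> ('m, 'e) chart \<Rightarrow> 'm \<Rightarrow> 'e \<Rightarrow> 'e" where
  "comps A c p u = change_comps (chart_at A p) c p u"

definition of_comps ::
  "('m, 'e::euclidean_space) chart set \<Rightarrow> ('m, 'e) chart \<Rightarrow> 'm \<Rightarrow> 'e \<Rightarrow> 'e" where
  "of_comps A c p u = change_comps c (chart_at A p) p u"

definition metric_in_chart ::
  "('m, 'e::euclidean_space) chart set \<Rightarrow> ('m, 'e) metric \<Rightarrow> ('m, 'e) chart \<Rightarrow>
   'e \<Rightarrow> 'e \<Rightarrow> 'e \<Rightarrow> real" where
  "metric_in_chart A g c x u v =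
     (let p = chart_inv c x in g p (of_comps A c p u) (of_comps A c p v))"

locale riemannian_manifold =
  fixes A :: "('m::{t2_space, second_countable_topology}, 'e::euclidean_space) chart set"
    and g :: "('m, 'e) metric"
  assumes connected: "connected (UNIV :: 'm set)"
    and atlas: "smooth_atlas A"
    and metric_bilinear: "\<And>p. bilinear (g p)"
    and metric_sym: "\<And>p u v. g p u v = g p v u"
    and metric_pos: "\<And>p u. u \<noteq> 0 \<Longrightarrow> g p u u > 0"
    and metric_smooth:
      "\<And>c u v. c \<in> A \<Longrightarrow> smooth_on (\<lambda>x. metric_in_chart A g c x u v) (snd c ` fst c)"

definition gnorm :: "('m, 'e) metric \<Rightarrow> 'm \<Rightarrow> 'e \<Rightarrow> real" where
  "gnorm g p u = sqrt (g p u u)"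


section \<open>Curves and the Riemannian distance\<close>

text \<open>In this section and the next, \<open>I\<close> is an interval with more than one point; derivatives at
  its end points are one-sided.\<close>

definition chart_velocity ::
  "('m, 'e::euclidean_space) chart \<Rightarrow> real set \<Rightarrow> (real \<Rightarrow> 'm) \<Rightarrow> real \<Rightarrow> 'e" where
  "chart_velocity c I \<gamma> t = vector_derivative (snd c \<circ> \<gamma>) (at t within I)"

definition velocity ::
  "('m, 'e::euclidean_space) chart set \<Rightarrow> real set \<Rightarrow> (real \<Rightarrow> 'm) \<Rightarrow> real \<Rightarrow> 'e" where
  "velocity A I \<gamma> t = chart_velocity (chart_at A (\<gamma> t)) I \<gamma> t"

definition C1_curve ::
  "('m::topological_space, 'e::euclidean_space) chart set \<Rightarrow> real set \<Rightarrow> (real \<Rightarrow> 'm) \<Rightarrow> bool" where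
  "C1_curve A I \<gamma> \<longleftrightarrow> continuous_on I \<gamma> \<and>
     (\<forall>c\<in>A. (\<forall>t\<in>I. \<gamma> t \<in> fst c \<longrightarrow> (snd c \<circ> \<gamma>) differentiable (at t within I)) \<and>
        continuous_on {t\<in>I. \<gamma> t \<in> fst c} (chart_velocity c I \<gamma>))"

definition partition_points :: "nat \<Rightarrow> (nat \<Rightarrow> real) \<Rightarrow> bool" where
  "partition_points n \<tau> \<longleftrightarrow> n \<ge> 1 \<and> (\<forall>i<n. \<tau> i < \<tau> (Suc i))"

definition piecewise_C1_length ::
  "('m::topological_space, 'e::euclidean_space) chart set \<Rightarrow> ('m, 'e) metric \<Rightarrow>
   nat \<Rightarrow> (nat \<Rightarrow> real) \<Rightarrow> (real \<Rightarrow> 'm) \<Rightarrow> real" where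
  "piecewise_C1_length A g n \<tau> \<gamma> =
     (\<Sum>i<n. integral {\<tau> i..\<tau> (Suc i)}
        (\<lambda>t. gnorm g (\<gamma> t) (velocity A {\<tau> i..\<tau> (Suc i)} \<gamma> t)))"

definition riem_dist ::
  "('m::topological_space, 'e::euclidean_space) chart set \<Rightarrow> ('m, 'e) metric \<Rightarrow>
   'm \<Rightarrow> 'm \<Rightarrow> real" where
  "riem_dist A g p q =
     Inf {piecewise_C1_length A g n \<tau> \<gamma> | n \<tau> \<gamma>. partition_points n \<tau> \<and>
        (\<forall>i<n. C1_curve A {\<tau> i..\<tau> (Suc i)} \<gamma>) \<and> \<gamma> (\<tau> 0) = p \<and> \<gamma> (\<tau> n) = q}"


section \<open>Levi-Civita connection, geodesics, parallel transport, exponential map\<close>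

text \<open>The Christoffel symbols of a chart, as the bilinear map with
  \<open>(\<Gamma>(u,v))\<^sup>k = \<Gamma>\<^sup>k\<^sub>i\<^sub>j u\<^sup>i v\<^sup>j\<close>, are given by the Koszul formula for the (commuting) coordinate
  vector fields.\<close>

definition christoffel ::
  "('m, 'e::euclidean_space) chart set \<Rightarrow> ('m, 'e) metric \<Rightarrow> ('m, 'e) chart \<Rightarrow>
   'e \<Rightarrow> 'e \<Rightarrow> 'e \<Rightarrow> 'e" where
  "christoffel A g c x u v = (THE z. \<forall>w.
     2 * metric_in_chart A g c x z w =
       frechet_derivative (\<lambda>y. metric_in_chart A g c y v w) (at x) u
     + frechet_derivative (\<lambda>y. metric_in_chart A g c y u w) (at x) v
     - frechet_derivative (\<lambda>y. metric_in_chart A g c y u v) (at x) w)"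

text \<open>A vector field \<open>X\<close> along a curve \<open>\<gamma>\<close> (with \<open>X t\<close> a tangent vector at \<open>\<gamma> t\<close>) is parallel if its
  covariant derivative vanishes: in every chart, \<open>X' + \<Gamma>(\<gamma>', X) = 0\<close>.\<close>

definition parallel_along ::
  "('m, 'e::euclidean_space) chart set \<Rightarrow> ('m, 'e) metric \<Rightarrow> real set \<Rightarrow>
   (real \<Rightarrow> 'm) \<Rightarrow> (real \<Rightarrow> 'e) \<Rightarrow> bool" where
  "parallel_along A g I \<gamma> X \<longleftrightarrow>
     (\<forall>t\<in>I. \<forall>c\<in>A. \<gamma> t \<in> fst c \<longrightarrow>
        ((\<lambda>s. comps A c (\<gamma> s) (X s)) has_vector_derivative
          - christoffel A g c (snd c (\<gamma> t)) (chart_velocity c I \<gamma> t) (comps A c (\<gamma> t) (X t)))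
        (at t within I))"

definition geodesic ::
  "('m::topological_space, 'e::euclidean_space) chart set \<Rightarrow> ('m, 'e) metric \<Rightarrow> real set \<Rightarrow>
   (real \<Rightarrow> 'm) \<Rightarrow> bool" where
  "geodesic A g I \<gamma> \<longleftrightarrow> C1_curve A I \<gamma> \<and> parallel_along A g I \<gamma> (velocity A I \<gamma>)"

definition parallel_transport ::
  "('m, 'e::euclidean_space) chart set \<Rightarrow> ('m, 'e) metric \<Rightarrow> real \<Rightarrow> real \<Rightarrow>
   (real \<Rightarrow> 'm) \<Rightarrow> 'e \<Rightarrow> 'e" where
  "parallel_transport A g a b \<gamma> u =
     (THE w. \<exists>X. parallel_along A g {a..b} \<gamma> X \<and> X a = u \<and> X b = w)"

text \<open>Completeness means that every geodesic extends to the whole real line, so that the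
  exponential map is defined on every tangent space.\<close>

locale complete_riemannian_manifold = riemannian_manifold A g
  for A :: "('m::{t2_space, second_countable_topology}, 'e::euclidean_space) chart set"
    and g :: "('m, 'e) metric" +
  assumes complete: "\<And>p v. \<exists>\<gamma>. geodesic A g UNIV \<gamma> \<and> \<gamma> 0 = p \<and> velocity A UNIV \<gamma> 0 = v"

text \<open>By uniqueness of geodesics the choice of \<open>\<gamma>\<close> is immaterial.\<close>

definition riem_exp ::
  "('m::topological_space, 'e::euclidean_space) chart set \<Rightarrow> ('m, 'e) metric \<Rightarrow>
   'm \<Rightarrow> 'e \<Rightarrow> 'm" where
  "riem_exp A g p v =
     (SOME \<gamma>. geodesic A g UNIV \<gamma> \<and> \<gamma> 0 = p \<and> velocity A UNIV \<gamma> 0 = v) 1"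


section \<open>Differentiable functions and their gradients\<close>

definition differentiable_fun ::
  "('m, 'e::euclidean_space) chart set \<Rightarrow> ('m \<Rightarrow> real) \<Rightarrow> bool" where
  "differentiable_fun A f \<longleftrightarrow>
     (\<forall>c\<in>A. \<forall>p\<in>fst c. (f \<circ> chart_inv c) differentiable (at (snd c p)))"

definition differential ::
  "('m, 'e::euclidean_space) chart set \<Rightarrow> ('m \<Rightarrow> real) \<Rightarrow> 'm \<Rightarrow> 'e \<Rightarrow> real" where
  "differential A f p u =
     frechet_derivative (f \<circ> chart_inv (chart_at A p)) (at (snd (chart_at A p) p)) u"

definition riem_grad ::
  "('m, 'e::euclidean_space) chart set \<Rightarrow> ('m, 'e) metric \<Rightarrow> ('m \<Rightarrow> real) \<Rightarrow> 'm \<Rightarrow> 'e" where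
  "riem_grad A g f p = (THE w. \<forall>u. g p w u = differential A f p u)"

definition lipschitz_grad ::
  "('m::topological_space, 'e::euclidean_space) chart set \<Rightarrow> ('m, 'e) metric \<Rightarrow>
   ('m \<Rightarrow> real) \<Rightarrow> real \<Rightarrow> bool" where
  "lipschitz_grad A g f L \<longleftrightarrow>
     (\<forall>p q a b \<gamma>. a < b \<and> geodesic A g {a..b} \<gamma> \<and> \<gamma> a = p \<and> \<gamma> b = q \<longrightarrow>
        gnorm g q (parallel_transport A g a b \<gamma> (riem_grad A g f p) - riem_grad A g f q)
          \<le> L * riem_dist A g p q)"


section \<open>The MAdaGrad iteration\<close>

text \<open>At an iterate with vanishing gradient, where the algorithm stops, the recursion leaves
  \<open>x\<close>, \<open>\<beta>\<close> and \<open>\<alpha>\<close> constant.\<close>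

definition madagrad ::
  "('m::topological_space, 'e::euclidean_space) chart set \<Rightarrow> ('m, 'e) metric \<Rightarrow>
   ('m \<Rightarrow> real) \<Rightarrow> real \<Rightarrow> 'm \<Rightarrow>
   (nat \<Rightarrow> 'm) \<Rightarrow> (nat \<Rightarrow> real) \<Rightarrow> (nat \<Rightarrow> real) \<Rightarrow> bool" where
  "madagrad A g f \<eta> x0 x \<beta> \<alpha> \<longleftrightarrow>
     x 0 = x0 \<and> \<beta> 0 = 0 \<and>
     (\<forall>k. \<beta> (Suc k) = \<beta> k + (gnorm g (x k) (riem_grad A g f (x k)))\<^sup>2 \<and>
          \<alpha> k = \<eta> / sqrt (\<beta> (Suc k)) \<and>
          x (Suc k) = riem_exp A g (x k) (- \<alpha> k *\<^sub>R riem_grad A g f (x k)))"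

text \<open>The infimum of the empty set of iterations is \<open>\<infinity>\<close>.\<close>

definition first_iteration :: "(nat \<Rightarrow> real) \<Rightarrow> real \<Rightarrow> enat" where
  "first_iteration r \<epsilon> = (INF k\<in>{k. r k \<le> \<epsilon>}. enat k)"

end

theory Submission
  imports Defs
begin

text \<open>
  The proof combines a geometric inequality with the analysis of a recursion for real numbers.

  The geometric part is the descent inequality
  \<open>f (exp\<^sub>p v) \<le> f p + \<langle>grad f p, v\<rangle> + L / 2 * \<parallel>v\<parallel>\<^sup>2\<close> (lemma \<open>descent\<close>). Along a geodesic \<open>\<gamma>\<close>, the derivative of
  \<open>f \<circ> \<gamma>\<close> is the inner product of the gradient with the velocity. The velocity is parallel and parallel
  transport is an isometry, so that the Lipschitz condition, which compares the gradient at \<open>\<gamma> t\<close> with the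
  transported initial gradient, bounds the change of this derivative by \<open>L * t * \<parallel>v\<parallel>\<^sup>2\<close>. The Lipschitz
  condition speaks of parallel transport through a definite description; to use it, one needs that
  parallel fields exist and are unique. Existence (\<open>parallel_exists\<close>) comes from linear differential
  equations in charts (\<open>linear_ode_exists\<close>), which are compatible by the transformation law of the
  Christoffel symbols (\<open>christoffel_transformation\<close>); uniqueness is a consequence of the isometry
  property (\<open>parallel_isometry\<close>).

  For the recursion, let \<open>s k\<close> be the gap \<open>f (x k) - f\<^sup>*\<close>, let \<open>G k\<close> be the norm of the gradient at \<open>x k\<close>, and let \<open>K\<close> be
  the first index with \<open>sqrt (\<beta> (K + 1)) \<ge> \<eta> * L\<close>, if it exists. The iterations before \<open>K\<close> form the first
  phase, and the others the second one. From \<open>K\<close> on, the step sizes are at most \<open>1 / L\<close>, and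
  \<open>s k + \<eta> / 2 * sqrt (\<beta> k)\<close> is nonincreasing; therefore the step sizes are at least \<open>\<alpha>min\<close>, and the gap
  decreases by the factor \<open>r = 1 - \<mu> * \<alpha>min / 2\<close> in every step (\<open>late_decay\<close>). If \<open>G 0 \<ge> \<eta> * L\<close> then
  \<open>K = 0\<close>, and this is all. Otherwise, as long as the gap exceeds \<open>\<epsilon>\<close>, every step adds at least \<open>\<mu> * \<epsilon>\<close> to
  \<open>\<beta>\<close>, which bounds \<open>K\<close> by \<open>1\<close> plus the logarithmic term (\<open>early_length\<close>); and if the gap reaches \<open>\<epsilon>\<close> before
  \<open>K\<close>, this estimate already bounds the number of iterations.

  Both phases come with a rounding, and adding the two bounds naively would lose one iteration. It is
  recovered by an estimate of \<open>s K\<close> that keeps the decrease due to the very first step: the gap \<open>s K\<close> is not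
  only below the constant \<open>C = s 0 + \<eta> ^ 4 * L ^ 3 / (2 * (G 0)\<^sup>2)\<close>, but below \<open>C - L * \<eta>\<^sup>2 / 2\<close> and hence below
  \<open>r * C\<close> (\<open>early_bound\<close>), so that the second phase has one contraction in advance.
\<close>

section \<open>Families of linear maps\<close>

lemma linear_Basis_expansion:
  fixes F :: "'a::euclidean_space \<Rightarrow> 'b::real_vector"
  assumes "linear F"
  shows "F v = (\<Sum>i\<in>Basis. (v \<bullet> i) *\<^sub>R F i)"
proof -
  have "F v = F (\<Sum>i\<in>Basis. (v \<bullet> i) *\<^sub>R i)"
    by (simp add: euclidean_representation)
  also have "\<dots> = (\<Sum>i\<in>Basis. (v \<bullet> i) *\<^sub>R F i)"
    using assms by (simp add: linear_sum linear_scale)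
  finally show ?thesis .
qed

text \<open>Product rule for a linear map applied to a vector, when both depend on time and the family of
linear maps is only known to be differentiable pointwise.\<close>

lemma has_vector_derivative_linear_apply:
  fixes F :: "real \<Rightarrow> 'a::euclidean_space \<Rightarrow> 'b::real_normed_vector"
  assumes "t \<in> S" and ev: "\<forall>\<^sub>F s in at t within S. linear (F s)" and "linear (F t)" and "linear F'"
    and F: "\<And>v. ((\<lambda>s. F s v) has_vector_derivative F' v) (at t within S)"
    and Z: "(Z has_vector_derivative Z') (at t within S)"
  shows "((\<lambda>s. F s (Z s)) has_vector_derivative F' (Z t) + F t Z') (at t within S)"
proof -
  have "((\<lambda>s. \<Sum>i\<in>Basis. (Z s \<bullet> i) *\<^sub>R F s i) has_vector_derivative
      (\<Sum>i\<in>Basis. (Z t \<bullet> i) *\<^sub>R F' i + (Z' \<bullet> i) *\<^sub>R F t i)) (at t within S)"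
  proof (rule has_vector_derivative_sum)
    fix i :: 'a
    have "((\<lambda>s. Z s \<bullet> i) has_real_derivative (Z' \<bullet> i)) (at t within S)"
      using bounded_linear.has_vector_derivative[OF bounded_linear_inner_left Z]
      by (simp add: has_real_derivative_iff_has_vector_derivative)
    from has_vector_derivative_scaleR[OF this F[of i]]
    show "((\<lambda>s. (Z s \<bullet> i) *\<^sub>R F s i) has_vector_derivative
        (Z t \<bullet> i) *\<^sub>R F' i + (Z' \<bullet> i) *\<^sub>R F t i) (at t within S)" .
  qed
  also have "(\<Sum>i\<in>Basis. (Z t \<bullet> i) *\<^sub>R F' i + (Z' \<bullet> i) *\<^sub>R F t i) = F' (Z t) + F t Z'"
    using assms by (simp add: sum.distrib linear_Basis_expansion[of F' "Z t"]
        linear_Basis_expansion[of "F t" Z'])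
  finally have D: "((\<lambda>s. \<Sum>i\<in>Basis. (Z s \<bullet> i) *\<^sub>R F s i) has_vector_derivative
      F' (Z t) + F t Z') (at t within S)" .
  have ev': "\<forall>\<^sub>F s in at t within S. (\<Sum>i\<in>Basis. (Z s \<bullet> i) *\<^sub>R F s i) = F s (Z s)"
    using ev by eventually_elim (rule linear_Basis_expansion[symmetric])
  have eq: "(\<Sum>i\<in>Basis. (Z t \<bullet> i) *\<^sub>R F t i) = F t (Z t)"
    using \<open>linear (F t)\<close> by (rule linear_Basis_expansion[symmetric])
  show ?thesis
    using has_derivative_transform_eventually[OF D[unfolded has_vector_derivative_def] ev' eq \<open>t \<in> S\<close>]
    by (simp add: has_vector_derivative_def)
qed

lemma continuous_on_linear_apply:
  fixes F :: "'t::topological_space \<Rightarrow> 'a::euclidean_space \<Rightarrow> 'b::real_normed_vector"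
  assumes "\<And>t. t \<in> S \<Longrightarrow> linear (F t)" and "\<And>v. continuous_on S (\<lambda>t. F t v)"
    and "continuous_on S Z"
  shows "continuous_on S (\<lambda>t. F t (Z t))"
proof -
  have "continuous_on S (\<lambda>t. \<Sum>i\<in>Basis. (Z t \<bullet> i) *\<^sub>R F t i)"
    using assms by (intro continuous_intros)
  then show ?thesis
    by (rule continuous_on_eq) (simp add: linear_Basis_expansion[symmetric] assms)
qed

section \<open>Positive definite bilinear forms\<close>

text \<open>The vector that represents the functional \<open>B z\<close> with respect to the Euclidean inner product.\<close>

definition flat :: "('a \<Rightarrow> 'a \<Rightarrow> real) \<Rightarrow> 'a::euclidean_space \<Rightarrow> 'a" where
  "flat B z = (\<Sum>i\<in>Basis. B z i *\<^sub>R i)"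

lemma inner_flat:
  assumes "bilinear B"
  shows "flat B z \<bullet> w = B z w"
proof -
  have "flat B z \<bullet> w = (\<Sum>i\<in>Basis. (w \<bullet> i) *\<^sub>R B z i)"
    by (simp add: flat_def inner_sum_left inner_commute[of w] mult.commute)
  also have "\<dots> = B z w"
    using assms by (simp add: linear_Basis_expansion[of "B z" w] bilinear_def)
  finally show ?thesis .
qed

lemma linear_flat:
  assumes "bilinear B"
  shows "linear (flat B)"
proof (rule linearI)
  show "flat B (x + y) = flat B x + flat B y" for x y
    using assms by (simp add: flat_def bilinear_ladd scaleR_add_left sum.distrib)
  show "flat B (c *\<^sub>R x) = c *\<^sub>R flat B x" for c x
    using assms by (simp add: flat_def bilinear_lmul scaleR_sum_right)
qed

lemma inj_flat:
  assumes "bilinear B" and "\<And>u. u \<noteq> 0 \<Longrightarrow> B u u > 0"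
  shows "inj (flat B)"
proof -
  have "x = 0" if "flat B x = 0" for x
    using inner_flat[OF assms(1), of x x] assms(2)[of x] that by force
  then show ?thesis
    using linear_flat[OF assms(1)] linear_injective_0 by blast
qed

text \<open>Riesz representation for a form that need not be symmetric. It makes the definite descriptions of
the gradient and of the Christoffel symbols meaningful.\<close>

lemma form_representation:
  fixes B :: "'a::euclidean_space \<Rightarrow> 'a \<Rightarrow> real"
  assumes B: "bilinear B" "\<And>u. u \<noteq> 0 \<Longrightarrow> B u u > 0" and k: "linear k"
  shows "\<exists>!z. \<forall>w. B z w = k w"
proof -
  have inj: "inj (flat B)" and lin: "linear (flat B)"
    using inj_flat linear_flat B by blast+
  then have "surj (flat B)"
    using linear_injective_imp_surjective by blast
  then obtain z where z: "flat B z = (\<Sum>i\<in>Basis. k i *\<^sub>R i)" by (metis surjD)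
  have "B z w = k w" for w
  proof -
    have "B z w = (\<Sum>i\<in>Basis. k i *\<^sub>R i) \<bullet> w"
      using inner_flat[OF B(1), of z w] z by simp
    also have "\<dots> = (\<Sum>i\<in>Basis. (w \<bullet> i) *\<^sub>R k i)"
      by (simp add: inner_sum_left inner_commute[of w] mult.commute)
    also have "\<dots> = k w" using k by (rule linear_Basis_expansion[symmetric])
    finally show ?thesis .
  qed
  moreover have "y = z" if "\<forall>w. B y w = k w" "\<forall>w. B z w = k w" for y z
  proof -
    have "flat B y = flat B z" using that by (simp add: flat_def)
    with inj show ?thesis by (simp add: inj_eq)
  qed
  ultimately show ?thesis by blast
qed

text \<open>The representing vectors of a continuous family of functionals with respect to a continuous family
of forms depend continuously on the parameter: near \<open>t0\<close> the map \<open>flat (B t)\<close> is a small perturbation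
of \<open>flat (B t0)\<close>, which is bounded below.\<close>

lemma continuous_on_form_representation:
  fixes B :: "'t::topological_space \<Rightarrow> 'a::euclidean_space \<Rightarrow> 'a \<Rightarrow> real"
  assumes B: "\<And>t. t \<in> S \<Longrightarrow> bilinear (B t)" "\<And>t u. t \<in> S \<Longrightarrow> u \<noteq> 0 \<Longrightarrow> B t u u > 0"
    and Bc: "\<And>u v. continuous_on S (\<lambda>t. B t u v)"
    and kc: "\<And>w. continuous_on S (\<lambda>t. k t w)"
    and z: "\<And>t w. t \<in> S \<Longrightarrow> B t (z t) w = k t w"
  shows "continuous_on S z"
  unfolding continuous_on_def
proof
  fix t0 assume t0: "t0 \<in> S"
  obtain c where c: "c > 0" "\<And>x. c * norm x \<le> norm (flat (B t0) x)"
    using linear_inj_bounded_below_pos[OF linear_flat[OF B(1)[OF t0]] inj_flat[OF B(1)[OF t0] B(2)[OF t0]]]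
    by blast
  define h where "h t w = k t w - B t (z t0) w" for t w
  define H where "H t = (\<Sum>i\<in>Basis. \<bar>h t i\<bar>)" for t
  define E where "E t = (\<Sum>i\<in>Basis. \<Sum>j\<in>Basis. \<bar>B t i j - B t0 i j\<bar>)" for t
  have "continuous_on S H"
    unfolding H_def h_def by (intro continuous_intros Bc kc)
  moreover have "H t0 = 0" using t0 z by (simp add: H_def h_def)
  ultimately have H: "(H \<longlongrightarrow> 0) (at t0 within S)"
    using t0 by (metis continuous_on_def)
  have "continuous_on S E"
    unfolding E_def by (intro continuous_intros Bc)
  moreover have "E t0 = 0" by (simp add: E_def)
  ultimately have "(E \<longlongrightarrow> 0) (at t0 within S)"
    using t0 by (metis continuous_on_def)
  then have ev: "\<forall>\<^sub>F t in at t0 within S. E t < c / 2"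
    by (rule order_tendstoD(2)) (use c in simp)
  have bound: "norm (z t - z t0) \<le> 2 / c * H t" if t: "t \<in> S" and Et: "E t < c / 2" for t
  proof -
    define d where "d = z t - z t0"
    have "norm (flat (B t0) d - flat (B t) d) \<le> E t * norm d"
    proof -
      have "norm (flat (B t0) d - flat (B t) d)
          = norm (\<Sum>i\<in>Basis. (B t0 d i - B t d i) *\<^sub>R i)"
        by (simp add: flat_def sum_subtractf scaleR_diff_left)
      also have "\<dots> \<le> (\<Sum>i\<in>Basis. norm ((B t0 d i - B t d i) *\<^sub>R i))" by (rule norm_sum)
      also have "\<dots> = (\<Sum>i\<in>Basis. \<bar>B t0 d i - B t d i\<bar>)" by simp
      also have "\<dots> \<le> (\<Sum>i\<in>Basis. \<Sum>j\<in>Basis. \<bar>B t j i - B t0 j i\<bar> * norm d)"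
      proof (rule sum_mono)
        fix i :: 'a
        have lin: "linear (\<lambda>d. B t d i)" "linear (\<lambda>d. B t0 d i)"
          using B(1)[OF t] B(1)[OF t0] by (auto simp: bilinear_def)
        have "B t0 d i - B t d i = (\<Sum>j\<in>Basis. (d \<bullet> j) *\<^sub>R (B t0 j i - B t j i))"
          unfolding linear_Basis_expansion[OF lin(1), of d] linear_Basis_expansion[OF lin(2), of d]
          by (simp add: sum_subtractf algebra_simps)
        also have "\<bar>\<dots>\<bar> \<le> (\<Sum>j\<in>Basis. \<bar>(d \<bullet> j) *\<^sub>R (B t0 j i - B t j i)\<bar>)" by (rule sum_abs)
        also have "\<dots> \<le> (\<Sum>j\<in>Basis. \<bar>B t j i - B t0 j i\<bar> * norm d)"
          by (rule sum_mono)
            (simp add: abs_mult mult.commute mult_right_mono Basis_le_norm abs_minus_commute)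
        finally show "\<bar>B t0 d i - B t d i\<bar> \<le> (\<Sum>j\<in>Basis. \<bar>B t j i - B t0 j i\<bar> * norm d)" .
      qed
      also have "\<dots> = E t * norm d"
        unfolding E_def by (subst sum.swap) (simp add: sum_distrib_right)
      finally show ?thesis .
    qed
    moreover have "norm (flat (B t) d) \<le> H t"
    proof -
      have "flat (B t) d = (\<Sum>i\<in>Basis. h t i *\<^sub>R i)"
        using z[OF t] bilinear_lsub[OF B(1)[OF t]] by (simp add: flat_def d_def h_def)
      also have "norm \<dots> \<le> (\<Sum>i\<in>Basis. norm (h t i *\<^sub>R i))" by (rule norm_sum)
      finally show ?thesis by (simp add: H_def)
    qed
    moreover have "norm (flat (B t0) d) \<le> norm (flat (B t) d) + norm (flat (B t0) d - flat (B t) d)"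
      by (rule norm_triangle_sub)
    moreover have "c * norm d \<le> norm (flat (B t0) d)" by (rule c)
    moreover have "E t * norm d \<le> c / 2 * norm d"
      using Et by (intro mult_right_mono) auto
    ultimately have "c / 2 * norm d \<le> H t" by linarith
    then show ?thesis using c(1) by (simp add: d_def field_simps)
  qed
  have "((\<lambda>t. z t - z t0) \<longlongrightarrow> 0) (at t0 within S)"
  proof (rule Lim_null_comparison)
    show "\<forall>\<^sub>F t in at t0 within S. norm (z t - z t0) \<le> 2 / c * H t"
    proof -
      have "\<forall>\<^sub>F t in at t0 within S. t \<in> S" by (simp add: eventually_at_filter)
      with ev show ?thesis by eventually_elim (rule bound)
    qed
    show "((\<lambda>t. 2 / c * H t) \<longlongrightarrow> 0) (at t0 within S)"
      by (rule tendsto_mult_right_zero[OF H])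
  qed
  then show "(z \<longlongrightarrow> z t0) (at t0 within S)"
    using Lim_null by blast
qed

section \<open>Linear differential equations\<close>

text \<open>Global existence on a compact interval. The Picard iterates \<open>P n\<close>, taken as the terms of a series,
are bounded by \<open>norm u * (K * (t - a)) ^ n / fact n\<close>, where \<open>K\<close> bounds the operator norms, so
that the series converges uniformly and no subdivision of the interval is needed.\<close>

lemma linear_ode_exists:
  fixes M :: "real \<Rightarrow> 'a::euclidean_space \<Rightarrow> 'a"
  assumes ab: "a < b" and lin: "\<And>t. t \<in> {a..b} \<Longrightarrow> linear (M t)"
    and cont: "\<And>v. continuous_on {a..b} (\<lambda>t. M t v)"
  shows "\<exists>X. X a = u \<and> (\<forall>t\<in>{a..b}. (X has_vector_derivative M t (X t)) (at t within {a..b}))"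
proof -
  have "\<exists>C. \<forall>t\<in>{a..b}. norm (M t i) \<le> C" for i
    using compact_imp_bounded[OF compact_continuous_image[OF cont[of i]]]
    by (auto simp: bounded_iff)
  then obtain C where C: "\<And>i t. t \<in> {a..b} \<Longrightarrow> norm (M t i) \<le> C i" by metis
  define K where "K = (\<Sum>i\<in>Basis. C i)"
  have K: "norm (M t v) \<le> K * norm v" if "t \<in> {a..b}" for t v
  proof -
    have "norm (M t v) = norm (\<Sum>i\<in>Basis. (v \<bullet> i) *\<^sub>R M t i)"
      using linear_Basis_expansion[OF lin[OF that]] by metis
    also have "\<dots> \<le> (\<Sum>i\<in>Basis. norm ((v \<bullet> i) *\<^sub>R M t i))" by (rule norm_sum)
    also have "\<dots> \<le> (\<Sum>i\<in>Basis. norm v * C i)"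
      using C[OF that] by (intro sum_mono) (simp add: mult_mono Basis_le_norm)
    finally show ?thesis by (simp add: K_def sum_distrib_left mult.commute)
  qed
  define P where "P = rec_nat (\<lambda>t. u) (\<lambda>n p t. integral {a..t} (\<lambda>s. M s (p s)))"
  have P0: "P 0 = (\<lambda>t. u)" and PS: "P (Suc n) = (\<lambda>t. integral {a..t} (\<lambda>s. M s (P n s)))" for n
    by (simp_all add: P_def)
  have Pc: "continuous_on {a..b} (P n)" for n
  proof (induction n)
    case (Suc n)
    have "continuous_on {a..b} (\<lambda>s. M s (P n s))"
      by (rule continuous_on_linear_apply[OF lin cont Suc])
    then show ?case
      unfolding PS by (intro indefinite_integral_continuous_1 integrable_continuous_real)
  qed (simp add: P0)
  have PD: "(P (Suc n) has_vector_derivative M t (P n t)) (at t within {a..b})"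
    if "t \<in> {a..b}" for n t
    unfolding PS
    by (rule integral_has_vector_derivative[OF continuous_on_linear_apply[OF lin cont Pc] that])
  have Pa: "P (Suc n) a = 0" for n by (simp add: PS)
  define B where "B n t = norm u * (K * (t - a)) ^ n / fact n" for n t
  have K0: "K \<ge> 0"
    unfolding K_def using C[of a] ab order_trans[OF norm_ge_zero] by (intro sum_nonneg) auto
  have bnd: "norm (P n t) \<le> B n t" if "t \<in> {a..b}" for n t
    using that
  proof (induction n arbitrary: t)
    case (Suc n)
    show ?case
    proof (cases "t = a")
      case False
      then have at: "a < t" and tb: "t \<le> b" using Suc.prems by auto
      have "norm (P (Suc n) t - P (Suc n) a) \<le> B (Suc n) t - B (Suc n) a"
      proof (rule differentiable_bound_general[OF at])
        show "continuous_on {a..t} (P (Suc n))"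
          using Pc by (rule continuous_on_subset) (use tb in auto)
        show "continuous_on {a..t} (B (Suc n))"
          unfolding B_def by (intro continuous_intros) auto
        fix s assume s: "a < s" "s < t"
        then have s': "s \<in> {a..b}" "s < b" using tb by simp_all
        show "(P (Suc n) has_vector_derivative M s (P n s)) (at s)"
          using PD[OF s'(1)] at_within_Icc_at[OF s(1) s'(2)] by simp
        have "((\<lambda>s. K * (s - a)) has_real_derivative K) (at s)"
          by (auto intro!: derivative_eq_intros)
        from DERIV_cdivide[OF DERIV_cmult[OF DERIV_power_Suc[OF this]]]
        have "(B (Suc n) has_real_derivative
            norm u * ((1 + real n) * (K * (K * (s - a)) ^ n)) / fact (Suc n)) (at s)"
          unfolding B_def .
        moreover have "norm u * ((1 + real n) * (K * (K * (s - a)) ^ n)) / fact (Suc n) = K * B n s"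
          unfolding B_def fact_Suc by (simp add: divide_simps)
        ultimately have "(B (Suc n) has_real_derivative K * B n s) (at s)" by simp
        then show "(B (Suc n) has_vector_derivative K * B n s) (at s)"
          by (simp add: has_real_derivative_iff_has_vector_derivative)
        show "norm (M s (P n s)) \<le> K * B n s"
          using K[OF s'(1), of "P n s"] mult_left_mono[OF Suc.IH[OF s'(1)] K0] by linarith
      qed
      then show ?thesis using Pa by (simp add: B_def)
    qed (simp add: Pa B_def)
  qed (simp add: P0 B_def)
  define W where "W n = norm u * (K * (b - a)) ^ n / fact n" for n
  have BW: "norm (P n t) \<le> W n" if "t \<in> {a..b}" for n t
  proof -
    have "(K * (t - a)) ^ n \<le> (K * (b - a)) ^ n"
      using that K0 by (intro power_mono mult_left_mono mult_nonneg_nonneg) auto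
    then have "B n t \<le> W n"
      unfolding B_def W_def by (intro divide_right_mono mult_left_mono) auto
    with bnd[OF that] show ?thesis by (rule order_trans)
  qed
  have "summable (\<lambda>n. (K * (b - a)) ^ n / fact n)"
    using summable_exp[of "K * (b - a)"] by (simp add: field_simps)
  from summable_mult[OF this, of "norm u"] have Wsum: "summable W"
    unfolding W_def by (simp only: times_divide_eq_right)
  define X where "X t = (\<Sum>n. P n t)" for t
  have uX: "uniform_limit {a..b} (\<lambda>n t. \<Sum>i<n. P i t) X sequentially"
    unfolding X_def by (rule Weierstrass_m_test[OF BW Wsum])
  have Xsum: "summable (\<lambda>n. P n t)" if "t \<in> {a..b}" for t
    by (rule summable_comparison_test'[OF Wsum]) (rule BW[OF that])
  have Xc: "continuous_on {a..b} X"
    by (rule uniform_limit_theorem[OF always_eventually uX]) (simp_all add: continuous_on_sum Pc)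
  \<comment> \<open>Uniform convergence survives the application of \<open>M t\<close>, which allows integrating termwise.\<close>
  have MX: "uniform_limit {a..b} (\<lambda>n t. M t (\<Sum>i<n. P i t)) (\<lambda>t. M t (X t)) sequentially"
  proof (rule uniform_limitI)
    fix e :: real assume e: "e > 0"
    then have "e / (K + 1) > 0" using K0 by simp
    from uniform_limitD[OF uX this]
    show "\<forall>\<^sub>F n in sequentially. \<forall>t\<in>{a..b}. dist (M t (\<Sum>i<n. P i t)) (M t (X t)) < e"
    proof eventually_elim
      case (elim n)
      show ?case
      proof
        fix t assume t: "t \<in> {a..b}"
        have "dist (M t (\<Sum>i<n. P i t)) (M t (X t)) = norm (M t ((\<Sum>i<n. P i t) - X t))"
          using lin[OF t] by (simp add: dist_norm linear_diff)
        also have "\<dots> \<le> K * norm ((\<Sum>i<n. P i t) - X t)" by (rule K[OF t])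
        also have "\<dots> \<le> (K + 1) * norm ((\<Sum>i<n. P i t) - X t)" by (simp add: mult_right_mono)
        also have "\<dots> < e" using elim t K0 by (auto simp: dist_norm field_simps)
        finally show "dist (M t (\<Sum>i<n. P i t)) (M t (X t)) < e" .
      qed
    qed
  qed
  have int: "X t = u + integral {a..t} (\<lambda>s. M s (X s))" if t: "t \<in> {a..b}" for t
  proof -
    have sub: "{a..t} \<subseteq> {a..b}" using t by auto
    have ci: "(\<lambda>s. M s (P n s)) integrable_on {a..t}" for n
      by (intro integrable_continuous_real continuous_on_subset[OF _ sub]
          continuous_on_linear_apply[OF lin cont Pc])
    have fin: "integral {a..t} (\<lambda>s. M s (\<Sum>i<n. P i s)) = (\<Sum>i<n. P (Suc i) t)" for n
    proof -
      have "integral {a..t} (\<lambda>s. M s (\<Sum>i<n. P i s)) = integral {a..t} (\<lambda>s. \<Sum>i<n. M s (P i s))"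
        using sub by (intro integral_cong linear_sum lin) auto
      also have "\<dots> = (\<Sum>i<n. P (Suc i) t)"
        using ci by (simp add: integral_sum PS)
      finally show ?thesis .
    qed
    have "((\<lambda>n. integral {a..t} (\<lambda>s. M s (\<Sum>i<n. P i s))) \<longlongrightarrow> integral {a..t} (\<lambda>s. M s (X s)))
        sequentially"
    proof -
      have "uniform_limit (cbox a t) (\<lambda>n s. M s (\<Sum>i<n. P i s)) (\<lambda>s. M s (X s)) sequentially"
        using uniform_limit_on_subset[OF MX sub] by simp
      moreover have "continuous_on (cbox a t) (\<lambda>s. M s (\<Sum>i<n. P i s))" for n
      proof (rule continuous_on_subset)
        show "continuous_on {a..b} (\<lambda>s. M s (\<Sum>i<n. P i s))"
          by (intro continuous_on_linear_apply[OF lin cont] continuous_on_sum Pc)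
      qed (use sub in simp)
      ultimately obtain I J where
        I: "\<And>n. ((\<lambda>s. M s (\<Sum>i<n. P i s)) has_integral I n) (cbox a t)"
        and J: "((\<lambda>s. M s (X s)) has_integral J) (cbox a t)" and "I \<longlonglongrightarrow> J"
        using uniform_limit_integral_cbox[OF _ _ trivial_limit_sequentially] by blast
      moreover have "I = (\<lambda>n. integral {a..t} (\<lambda>s. M s (\<Sum>i<n. P i s)))"
        "J = integral {a..t} (\<lambda>s. M s (X s))"
        using integral_unique[OF I] integral_unique[OF J] by (simp_all add: fun_eq_iff)
      ultimately show ?thesis by simp
    qed
    then have "(\<lambda>n. P (Suc n) t) sums integral {a..t} (\<lambda>s. M s (X s))"
      unfolding fin sums_def .
    moreover have "(\<lambda>n. P (Suc n) t) sums (X t - u)"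
      using summable_sums[OF Xsum[OF t]] sums_split_initial_segment[of "\<lambda>n. P n t" "X t" 1]
      by (simp add: X_def P0)
    ultimately show ?thesis using sums_unique2 by fastforce
  qed
  have "(X has_vector_derivative M t (X t)) (at t within {a..b})" if t: "t \<in> {a..b}" for t
  proof (rule has_vector_derivative_transform[OF t])
    show "X s = u + integral {a..s} (\<lambda>s. M s (X s))" if "s \<in> {a..b}" for s by (rule int[OF that])
    have "((\<lambda>s. integral {a..s} (\<lambda>s. M s (X s))) has_vector_derivative M t (X t))
        (at t within {a..b})"
      by (rule integral_has_vector_derivative[OF continuous_on_linear_apply[OF lin cont Xc] t])
    from has_vector_derivative_add[OF has_vector_derivative_const this]
    show "((\<lambda>s. u + integral {a..s} (\<lambda>s. M s (X s))) has_vector_derivative M t (X t))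
        (at t within {a..b})" by simp
  qed
  moreover have "X a = u" using int[of a] ab by simp
  ultimately show ?thesis by blast
qed

section \<open>Symmetry of second derivatives\<close>

text \<open>Two applications of the mean value theorem to the second difference of \<open>h\<close> over the parallelogram
spanned by \<open>s *\<^sub>R u\<close> and \<open>s *\<^sub>R v\<close>.\<close>

lemma second_difference:
  fixes h :: "'a::real_normed_vector \<Rightarrow> real"
  assumes D: "\<And>y. y \<in> ball x r \<Longrightarrow> (h has_derivative D y) (at y)"
    and D2: "\<And>y. y \<in> ball x r \<Longrightarrow> ((\<lambda>y. D y u) has_derivative D2 y) (at y)"
    and s: "s > 0" "s * (norm u + norm v) < r"
  shows "\<exists>y\<in>ball x r.
    h (x + s *\<^sub>R u + s *\<^sub>R v) - h (x + s *\<^sub>R u) - h (x + s *\<^sub>R v) + h x = s * s * D2 y v"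
proof -
  have in_ball: "x + \<xi> *\<^sub>R u + \<zeta> *\<^sub>R v \<in> ball x r" if "0 \<le> \<xi>" "\<xi> \<le> s" "0 \<le> \<zeta>" "\<zeta> \<le> s" for \<xi> \<zeta>
  proof -
    have "norm (\<xi> *\<^sub>R u + \<zeta> *\<^sub>R v) \<le> \<xi> * norm u + \<zeta> * norm v"
      using norm_triangle_ineq[of "\<xi> *\<^sub>R u" "\<zeta> *\<^sub>R v"] that by simp
    also have "\<dots> \<le> s * norm u + s * norm v"
      using that by (intro add_mono mult_right_mono) auto
    also have "\<dots> < r" using s by (simp add: distrib_left)
    finally show ?thesis
      using norm_minus_cancel[of "\<xi> *\<^sub>R u + \<zeta> *\<^sub>R v"]
      by (simp add: dist_norm add.assoc del: norm_minus_cancel)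
  qed
  have der: "((\<lambda>\<tau>. F (p + \<tau> *\<^sub>R w)) has_real_derivative F' w) (at \<tau>)"
    if "(F has_derivative F') (at (p + \<tau> *\<^sub>R w))" for F :: "'a \<Rightarrow> real" and F' p w \<tau>
  proof -
    have "((\<lambda>\<tau>. p + \<tau> *\<^sub>R w) has_vector_derivative w) (at \<tau>)"
      by (auto intro!: derivative_eq_intros simp: has_vector_derivative_def)
    from vector_derivative_diff_chain_within[OF this has_derivative_at_withinI[OF that]]
    show ?thesis by (simp add: has_real_derivative_iff_has_vector_derivative o_def)
  qed
  have "((\<lambda>\<tau>. h ((x + s *\<^sub>R v) + \<tau> *\<^sub>R u) - h (x + \<tau> *\<^sub>R u)) has_real_derivative
      D ((x + s *\<^sub>R v) + \<tau> *\<^sub>R u) u - D (x + \<tau> *\<^sub>R u) u) (at \<tau>)" if "0 \<le> \<tau>" "\<tau> \<le> s" for \<tau>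
    using in_ball[of \<tau> s] in_ball[of \<tau> 0] that s(1)
    by (intro DERIV_diff der D) (simp_all add: algebra_simps)
  from MVT2[OF s(1) this] obtain \<xi> where \<xi>: "0 < \<xi>" "\<xi> < s" and
    1: "h ((x + s *\<^sub>R v) + s *\<^sub>R u) - h (x + s *\<^sub>R u) - (h (x + s *\<^sub>R v) - h x)
      = s * (D ((x + s *\<^sub>R v) + \<xi> *\<^sub>R u) u - D (x + \<xi> *\<^sub>R u) u)"
    by auto
  have "((\<lambda>\<tau>. D ((x + \<xi> *\<^sub>R u) + \<tau> *\<^sub>R v) u) has_real_derivative
      D2 ((x + \<xi> *\<^sub>R u) + \<tau> *\<^sub>R v) v) (at \<tau>)" if "0 \<le> \<tau>" "\<tau> \<le> s" for \<tau>
    using in_ball[of \<xi> \<tau>] \<xi> that by (intro der D2) simp_all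
  from MVT2[OF s(1) this] obtain \<zeta> where \<zeta>: "0 < \<zeta>" "\<zeta> < s" and
    2: "D ((x + \<xi> *\<^sub>R u) + s *\<^sub>R v) u - D (x + \<xi> *\<^sub>R u) u = s * D2 (x + \<xi> *\<^sub>R u + \<zeta> *\<^sub>R v) v"
    by auto
  have "(x + s *\<^sub>R v) + \<xi> *\<^sub>R u = (x + \<xi> *\<^sub>R u) + s *\<^sub>R v" by simp
  with 1 2 have "h (x + s *\<^sub>R u + s *\<^sub>R v) - h (x + s *\<^sub>R u) - h (x + s *\<^sub>R v) + h x
      = s * s * D2 (x + \<xi> *\<^sub>R u + \<zeta> *\<^sub>R v) v"
    by (simp add: algebra_simps)
  then show ?thesis using in_ball[of \<xi> \<zeta>] \<xi> \<zeta> by fastforce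
qed

text \<open>Here \<open>D2 y v u\<close> is the derivative in direction \<open>u\<close> of the directional derivative along \<open>v\<close>. The second
difference is symmetric in \<open>u\<close> and \<open>v\<close>, and divided by \<open>s * s\<close> it is close to both sides of the claim.\<close>

lemma symmetric_second_derivative:
  fixes \<phi> :: "'a::real_normed_vector \<Rightarrow> 'b::euclidean_space"
  assumes W: "open W" "x \<in> W"
    and D: "\<And>y. y \<in> W \<Longrightarrow> (\<phi> has_derivative D y) (at y)"
    and D2: "\<And>y v. y \<in> W \<Longrightarrow> ((\<lambda>y. D y v) has_derivative D2 y v) (at y)"
    and c: "\<And>u v. continuous_on W (\<lambda>y. D2 y u v)"
  shows "D2 x u v = D2 x v u"
proof (rule euclidean_eqI)
  fix b :: 'b assume b: "b \<in> Basis"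
  have "\<bar>D2 x u v \<bullet> b - D2 x v u \<bullet> b\<bar> \<le> e" if e: "e > 0" for e
  proof -
    have cb: "continuous_on W (\<lambda>y. D2 y p q \<bullet> b)" for p q
      using c[of p q] by (intro continuous_intros)
    have near: "\<exists>d>0. \<forall>y\<in>ball x d. y \<in> W \<and> \<bar>D2 y p q \<bullet> b - D2 x p q \<bullet> b\<bar> < e / 2" for p q
    proof -
      obtain d1 where d1: "d1 > 0" "ball x d1 \<subseteq> W" using W openE by blast
      have "0 < e / 2" using e by simp
      then obtain d2 where d2: "d2 > 0"
        "\<And>y. y \<in> W \<Longrightarrow> dist y x < d2 \<Longrightarrow> dist (D2 y p q \<bullet> b) (D2 x p q \<bullet> b) < e / 2"
        using cb[of p q] W(2) unfolding continuous_on_iff by meson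
      show ?thesis
        by (rule exI[of _ "min d1 d2"])
          (use d1 d2 in \<open>auto simp: dist_real_def dist_commute subset_iff\<close>)
    qed
    obtain d1 d2 where d: "d1 > 0" "d2 > 0"
      and d1: "\<forall>y\<in>ball x d1. y \<in> W \<and> \<bar>D2 y u v \<bullet> b - D2 x u v \<bullet> b\<bar> < e / 2"
      and d2: "\<forall>y\<in>ball x d2. y \<in> W \<and> \<bar>D2 y v u \<bullet> b - D2 x v u \<bullet> b\<bar> < e / 2"
      using near by meson
    define r where "r = min d1 d2"
    define s where "s = r / (2 * (norm u + norm v + 1))"
    have "r > 0" using d by (simp add: r_def)
    have pos: "norm u + norm v + 1 > 0" by (simp add: add_nonneg_pos)
    have s: "s > 0" unfolding s_def using \<open>r > 0\<close> pos by simp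
    have "s * (norm u + norm v) < s * (2 * (norm u + norm v + 1))"
      using s pos by (intro mult_strict_left_mono) auto
    also have "\<dots> = r" using pos by (simp add: s_def)
    finally have sr: "s * (norm u + norm v) < r" "s * (norm v + norm u) < r"
      by (simp_all add: add.commute)
    have Db: "((\<lambda>y. \<phi> y \<bullet> b) has_derivative (\<lambda>w. D y w \<bullet> b)) (at y)" if "y \<in> ball x r" for y
      using that d1 by (intro has_derivative_inner_left D) (auto simp: r_def)
    have D2b: "((\<lambda>y. D y p \<bullet> b) has_derivative (\<lambda>w. D2 y p w \<bullet> b)) (at y)"
      if "y \<in> ball x r" for y p
      using that d1 by (intro has_derivative_inner_left D2) (auto simp: r_def)
    obtain y1 where y1: "y1 \<in> ball x r" and
      e1: "\<phi> (x + s *\<^sub>R u + s *\<^sub>R v) \<bullet> b - \<phi> (x + s *\<^sub>R u) \<bullet> b - \<phi> (x + s *\<^sub>R v) \<bullet> b + \<phi> x \<bullet> b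
        = s * s * (D2 y1 u v \<bullet> b)"
      using second_difference[OF Db D2b s sr(1)] by blast
    obtain y2 where y2: "y2 \<in> ball x r" and
      e2: "\<phi> (x + s *\<^sub>R v + s *\<^sub>R u) \<bullet> b - \<phi> (x + s *\<^sub>R v) \<bullet> b - \<phi> (x + s *\<^sub>R u) \<bullet> b + \<phi> x \<bullet> b
        = s * s * (D2 y2 v u \<bullet> b)"
      using second_difference[OF Db D2b s sr(2)] by blast
    have "x + s *\<^sub>R v + s *\<^sub>R u = x + s *\<^sub>R u + s *\<^sub>R v" by simp
    note e2[unfolded this]
    with e1 have "s * s * (D2 y1 u v \<bullet> b) = s * s * (D2 y2 v u \<bullet> b)" by linarith
    then have "D2 y1 u v \<bullet> b = D2 y2 v u \<bullet> b" using s by simp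
    moreover have "\<bar>D2 y1 u v \<bullet> b - D2 x u v \<bullet> b\<bar> < e / 2" "\<bar>D2 y2 v u \<bullet> b - D2 x v u \<bullet> b\<bar> < e / 2"
      using y1 y2 d1 d2 by (auto simp: r_def)
    ultimately show ?thesis by linarith
  qed
  then have "\<bar>D2 x u v \<bullet> b - D2 x v u \<bullet> b\<bar> \<le> 0" using field_le_epsilon[of "\<bar>D2 x u v \<bullet> b - D2 x v u \<bullet> b\<bar>" 0] by simp
  then show "D2 x u v \<bullet> b = D2 x v u \<bullet> b" by simp
qed

section \<open>Christoffel symbols in coordinates\<close>

lemma smooth_on_has_derivative:
  assumes "smooth_on f S" and "x \<in> S"
  shows "(f has_derivative frechet_derivative f (at x)) (at x)"
proof -
  have "Ck_on (Suc 0) f S" using assms(1) unfolding smooth_on_def by blast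
  then show ?thesis using assms(2) by (simp add: frechet_derivative_works)
qed

lemma smooth_on_frechet_derivative:
  assumes "smooth_on f S"
  shows "smooth_on (\<lambda>x. frechet_derivative f (at x) v) S"
proof -
  have "Ck_on (Suc n) f S" for n using assms unfolding smooth_on_def by blast
  then show ?thesis by (simp add: smooth_on_def)
qed

lemma smooth_on_continuous_on: "smooth_on f S \<Longrightarrow> continuous_on S f"
  unfolding smooth_on_def by (metis Ck_on.simps(1))

text \<open>The Christoffel symbols of a metric \<open>m\<close> given in coordinates, detached from any manifold.\<close>

definition christoffel_map :: "('e::euclidean_space \<Rightarrow> 'e \<Rightarrow> 'e \<Rightarrow> real) \<Rightarrow> 'e \<Rightarrow> 'e \<Rightarrow> 'e \<Rightarrow> 'e" where
  "christoffel_map m x u v = (THE z. \<forall>w.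
     2 * m x z w =
       frechet_derivative (\<lambda>y. m y v w) (at x) u
     + frechet_derivative (\<lambda>y. m y u w) (at x) v
     - frechet_derivative (\<lambda>y. m y u v) (at x) w)"

lemma christoffel_eq: "christoffel A g c = christoffel_map (metric_in_chart A g c)"
  by (intro ext) (simp add: christoffel_def christoffel_map_def)

text \<open>A smooth Riemannian metric on an open subset of a Euclidean space, which is what a metric on a
manifold looks like in a chart.\<close>

locale coordinate_metric =
  fixes V :: "'e::euclidean_space set" and m :: "'e \<Rightarrow> 'e \<Rightarrow> 'e \<Rightarrow> real"
  assumes open_V: "open V"
    and bilin: "\<And>x. x \<in> V \<Longrightarrow> bilinear (m x)"
    and sym: "\<And>x u v. x \<in> V \<Longrightarrow> m x u v = m x v u"
    and pos: "\<And>x u. x \<in> V \<Longrightarrow> u \<noteq> 0 \<Longrightarrow> m x u u > 0"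
    and smooth: "\<And>u v. smooth_on (\<lambda>x. m x u v) V"
begin

text \<open>The derivative at \<open>x\<close> in direction \<open>u\<close> of the coefficient \<open>m y v w\<close>, with \<open>v\<close> and \<open>w\<close> held constant.\<close>

definition Dm :: "'e \<Rightarrow> 'e \<Rightarrow> 'e \<Rightarrow> 'e \<Rightarrow> real" where
  "Dm x u v w = frechet_derivative (\<lambda>y. m y v w) (at x) u"

lemma has_derivative_m: "x \<in> V \<Longrightarrow> ((\<lambda>y. m y v w) has_derivative (\<lambda>u. Dm x u v w)) (at x)"
  using smooth_on_has_derivative[OF smooth] by (simp add: Dm_def)

lemma Dm_eqI:
  assumes x: "x \<in> V" and "(f has_derivative D) (at x)" and "\<And>y. y \<in> V \<Longrightarrow> f y = m y v w"
  shows "Dm x u v w = D u"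
proof -
  have "((\<lambda>y. m y v w) has_derivative D) (at x)"
    by (rule has_derivative_transform_within_open[OF assms(2) open_V x assms(3)])
  then show ?thesis using has_derivative_unique[OF has_derivative_m[OF x]] by metis
qed

lemma Dm_sym: "x \<in> V \<Longrightarrow> Dm x u v w = Dm x u w v"
  by (rule Dm_eqI[OF _ has_derivative_m]) (auto intro: sym)

lemma linear_Dm:
  assumes x: "x \<in> V"
  shows "linear (\<lambda>u. Dm x u v w)" and "linear (\<lambda>v. Dm x u v w)" and "linear (\<lambda>w. Dm x u v w)"
proof -
  show "linear (\<lambda>u. Dm x u v w)"
    using has_derivative_linear[OF has_derivative_m[OF x]] .
  show 2: "linear (\<lambda>v. Dm x u v w)" for w
  proof (rule linearI)
    show "Dm x u (a + b) w = Dm x u a w + Dm x u b w" for a b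
      by (rule Dm_eqI[OF x has_derivative_add[OF has_derivative_m[OF x] has_derivative_m[OF x]]])
        (simp add: bilinear_ladd[OF bilin])
    show "Dm x u (r *\<^sub>R a) w = r *\<^sub>R Dm x u a w" for r a
      by (rule Dm_eqI[OF x has_derivative_scaleR_right[OF has_derivative_m[OF x]]])
        (simp add: bilinear_lmul[OF bilin])
  qed
  show "linear (\<lambda>w. Dm x u v w)" using 2[of v] Dm_sym[OF x, of u v] by simp
qed

lemma continuous_on_Dm: "continuous_on V (\<lambda>x. Dm x u v w)"
  unfolding Dm_def by (intro smooth_on_continuous_on smooth_on_frechet_derivative smooth)

lemma m_product_rule:
  assumes t: "t \<in> S" "y t \<in> V"
    and y: "(y has_vector_derivative y') (at t within S)"
    and X: "(X has_vector_derivative X') (at t within S)"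
    and Y: "(Y has_vector_derivative Y') (at t within S)"
  shows "((\<lambda>s. m (y s) (X s) (Y s)) has_vector_derivative
      Dm (y t) y' (X t) (Y t) + m (y t) X' (Y t) + m (y t) (X t) Y') (at t within S)"
proof -
  have "(y \<longlongrightarrow> y t) (at t within S)"
    using has_vector_derivative_continuous[OF y] by (simp add: continuous_within)
  then have ev: "\<forall>\<^sub>F s in at t within S. y s \<in> V"
    by (rule topological_tendstoD[OF _ open_V t(2)])
  have lin: "linear (\<lambda>v. m x v w)" "linear (\<lambda>w. m x v w)" if "x \<in> V" for x v w
    using bilin[OF that] by (auto simp: bilinear_def)
  have 1: "((\<lambda>s. m (y s) v w) has_vector_derivative Dm (y t) y' v w) (at t within S)" for v w
    using vector_derivative_diff_chain_within[OF y has_derivative_at_withinI[OF has_derivative_m[OF t(2)]]]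
    by (simp add: o_def)
  have 2: "((\<lambda>s. m (y s) (X s) w) has_vector_derivative
      Dm (y t) y' (X t) w + m (y t) X' w) (at t within S)" for w
    using ev lin(1)
    by (intro has_vector_derivative_linear_apply[where F = "\<lambda>s v. m (y s) v w" and F' = "\<lambda>v. Dm (y t) y' v w"]
        t lin linear_Dm 1 X) (auto elim: eventually_mono)
  have 3: "linear (\<lambda>w. Dm (y t) y' (X t) w + m (y t) X' w)"
    by (intro linear_compose_add lin linear_Dm t)
  show ?thesis
    using ev lin(2)
    by (intro has_vector_derivative_linear_apply[where F = "\<lambda>s. m (y s) (X s)"
          and F' = "\<lambda>w. Dm (y t) y' (X t) w + m (y t) X' w"] t lin 2 3 Y) (auto elim: eventually_mono)
qed

abbreviation \<Gamma> where "\<Gamma> \<equiv> christoffel_map m"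

lemma double_form:
  assumes "x \<in> V"
  shows "bilinear (\<lambda>z w. 2 * m x z w)" and "u \<noteq> 0 \<Longrightarrow> 2 * m x u u > 0"
proof -
  have "linear (\<lambda>z. 2 * f z)" if "linear f" for f :: "'e \<Rightarrow> real"
    using linear_compose_scale_right[OF that, of 2] by simp
  then show "bilinear (\<lambda>z w. 2 * m x z w)"
    using bilin[OF assms] by (simp add: bilinear_def)
  show "u \<noteq> 0 \<Longrightarrow> 2 * m x u u > 0"
    using pos[OF assms] by simp
qed

lemma koszul_ex1:
  assumes x: "x \<in> V"
  shows "\<exists>!z. \<forall>w. 2 * m x z w = Dm x u v w + Dm x v u w - Dm x w u v"
  by (intro form_representation[OF double_form[OF x]] linear_compose_add linear_compose_sub
      linear_Dm x)

lemma koszul: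
  assumes "x \<in> V"
  shows "2 * m x (\<Gamma> x u v) w = Dm x u v w + Dm x v u w - Dm x w u v"
  using theI'[OF koszul_ex1[OF assms, of u v]] by (simp add: christoffel_map_def Dm_def)

lemma \<Gamma>_eqI:
  assumes x: "x \<in> V" and "\<And>w. 2 * m x z w = Dm x u v w + Dm x v u w - Dm x w u v"
  shows "\<Gamma> x u v = z"
  using koszul_ex1[OF x, of u v] koszul[OF x, of u v] assms(2) by blast

lemma linear_\<Gamma>:
  assumes x: "x \<in> V"
  shows "linear (\<Gamma> x u)" and "linear (\<lambda>u. \<Gamma> x u v)"
proof -
  note D = linear_add[OF linear_Dm(1)[OF x]] linear_add[OF linear_Dm(2)[OF x]]
    linear_add[OF linear_Dm(3)[OF x]] linear_scale[OF linear_Dm(1)[OF x]]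
    linear_scale[OF linear_Dm(2)[OF x]] linear_scale[OF linear_Dm(3)[OF x]]
  show "linear (\<Gamma> x u)"
  proof (rule linearI; rule \<Gamma>_eqI[OF x])
    fix a b w :: 'e and r :: real
    show "2 * m x (\<Gamma> x u a + \<Gamma> x u b) w = Dm x u (a + b) w + Dm x (a + b) u w - Dm x w u (a + b)"
      using koszul[OF x, of u a w] koszul[OF x, of u b w]
      by (simp add: bilinear_ladd[OF bilin[OF x]] D)
    have "2 * m x (r *\<^sub>R \<Gamma> x u a) w = r * (2 * m x (\<Gamma> x u a) w)"
      by (simp add: bilinear_lmul[OF bilin[OF x]])
    then show "2 * m x (r *\<^sub>R \<Gamma> x u a) w
        = Dm x u (r *\<^sub>R a) w + Dm x (r *\<^sub>R a) u w - Dm x w u (r *\<^sub>R a)"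
      unfolding koszul[OF x] by (simp add: D algebra_simps)
  qed
  show "linear (\<lambda>u. \<Gamma> x u v)"
  proof (rule linearI; rule \<Gamma>_eqI[OF x])
    fix a b w :: 'e and r :: real
    show "2 * m x (\<Gamma> x a v + \<Gamma> x b v) w = Dm x (a + b) v w + Dm x v (a + b) w - Dm x w (a + b) v"
      using koszul[OF x, of a v w] koszul[OF x, of b v w]
      by (simp add: bilinear_ladd[OF bilin[OF x]] D)
    have "2 * m x (r *\<^sub>R \<Gamma> x a v) w = r * (2 * m x (\<Gamma> x a v) w)"
      by (simp add: bilinear_lmul[OF bilin[OF x]])
    then show "2 * m x (r *\<^sub>R \<Gamma> x a v) w
        = Dm x (r *\<^sub>R a) v w + Dm x v (r *\<^sub>R a) w - Dm x w (r *\<^sub>R a) v"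
      unfolding koszul[OF x] by (simp add: D algebra_simps)
  qed
qed

lemma continuous_on_\<Gamma>:
  assumes y: "continuous_on S y" "\<And>t. t \<in> S \<Longrightarrow> y t \<in> V" and u: "continuous_on S u"
  shows "continuous_on S (\<lambda>t. \<Gamma> (y t) (u t) v)"
proof (rule continuous_on_form_representation[where B = "\<lambda>t z w. 2 * m (y t) z w"])
  show "bilinear (\<lambda>z w. 2 * m (y t) z w)" if "t \<in> S" for t
    using double_form(1) y(2) that by blast
  show "0 < 2 * m (y t) u u" if "t \<in> S" "u \<noteq> 0" for t u
    using double_form(2) y(2) that by blast
  have sub: "y ` S \<subseteq> V" using y(2) by blast
  show "continuous_on S (\<lambda>t. 2 * m (y t) a b)" for a b
    using continuous_on_compose2[OF smooth_on_continuous_on[OF smooth] y(1) sub]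
    by (intro continuous_intros)
  have Dc: "continuous_on S (\<lambda>t. Dm (y t) a b c)" for a b c
    using continuous_on_compose2[OF continuous_on_Dm y(1) sub] .
  have lin: "linear (\<lambda>a. Dm (y t) a b c)" "linear (\<lambda>a. Dm (y t) b a c)" if "t \<in> S" for t b c
    using linear_Dm y(2)[OF that] by blast+
  show "continuous_on S (\<lambda>t. Dm (y t) (u t) v w + Dm (y t) v (u t) w - Dm (y t) w (u t) v)" for w
  proof -
    have 1: "continuous_on S (\<lambda>t. Dm (y t) (u t) v w)" for v w
      by (rule continuous_on_linear_apply[where F = "\<lambda>t a. Dm (y t) a v w", OF lin(1) Dc u])
    have 2: "continuous_on S (\<lambda>t. Dm (y t) v (u t) w)" for v w
      by (rule continuous_on_linear_apply[where F = "\<lambda>t a. Dm (y t) v a w", OF lin(2) Dc u])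
    show ?thesis by (intro continuous_on_diff continuous_on_add 1 2)
  qed
  show "2 * m (y t) (\<Gamma> (y t) (u t) v) w
      = Dm (y t) (u t) v w + Dm (y t) v (u t) w - Dm (y t) w (u t) v" if "t \<in> S" for t w
    by (rule koszul[OF y(2)[OF that]])
qed

text \<open>Compatibility of the connection with the metric: the inner product of two parallel fields along a
curve has derivative zero.\<close>

lemma parallel_m_derivative:
  assumes t: "t \<in> S" "y t \<in> V"
    and y: "(y has_vector_derivative y') (at t within S)"
    and X: "(X has_vector_derivative - \<Gamma> (y t) y' (X t)) (at t within S)"
    and Y: "(Y has_vector_derivative - \<Gamma> (y t) y' (Y t)) (at t within S)"
  shows "((\<lambda>s. m (y s) (X s) (Y s)) has_vector_derivative 0) (at t within S)"
proof -
  have "Dm (y t) y' (X t) (Y t) + m (y t) (- \<Gamma> (y t) y' (X t)) (Y t)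
      + m (y t) (X t) (- \<Gamma> (y t) y' (Y t)) = 0"
    using koszul[OF t(2), of y' "X t" "Y t"] koszul[OF t(2), of y' "Y t" "X t"]
      sym[OF t(2), of "X t" "\<Gamma> (y t) y' (Y t)"] Dm_sym[OF t(2)]
    by (simp add: bilinear_lneg[OF bilin[OF t(2)]] bilinear_rneg[OF bilin[OF t(2)]])
  then show ?thesis using m_product_rule[OF t y X Y] by simp
qed

end

lemma has_derivative_along_line:
  assumes "(F has_derivative F') (at x)"
  shows "((\<lambda>s. F (x + s *\<^sub>R u)) has_vector_derivative F' u) (at 0)"
proof -
  have "((\<lambda>s. x + s *\<^sub>R u) has_vector_derivative u) (at 0)"
    by (auto intro!: derivative_eq_intros simp: has_vector_derivative_def)
  from vector_derivative_diff_chain_within[OF this has_derivative_at_withinI, of F F'] assms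
  show ?thesis by (simp add: o_def)
qed

text \<open>The transformation law of the Christoffel symbols under a change of coordinates \<open>\<phi>\<close> with Jacobian
\<open>J\<close> and second derivative \<open>H\<close>. Differentiating the relation \<open>pull\<close> and inserting the result into the Koszul
formula gives the Koszul expression of \<open>m2\<close> and, by the symmetry of \<open>H\<close>, the single additional term
\<open>2 * m2 (\<phi> x) (H x u v) (J x w)\<close>.\<close>

lemma christoffel_transformation:
  fixes \<phi> :: "'e::euclidean_space \<Rightarrow> 'e"
  assumes m1: "coordinate_metric V1 m1" and m2: "coordinate_metric V2 m2"
    and W: "open W" "W \<subseteq> V1" "\<phi> ` W \<subseteq> V2" and sm: "smooth_on \<phi> W"
    and J: "J = (\<lambda>x. frechet_derivative \<phi> (at x))"
    and H: "H = (\<lambda>x u v. frechet_derivative (\<lambda>y. J y v) (at x) u)"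
    and pull: "\<And>x u v. x \<in> W \<Longrightarrow> m1 x u v = m2 (\<phi> x) (J x u) (J x v)"
    and x: "x \<in> W" and surj: "surj (J x)"
  shows "J x (christoffel_map m1 x u v) = H x u v + christoffel_map m2 (\<phi> x) (J x u) (J x v)"
proof -
  interpret m1: coordinate_metric V1 m1 by (rule m1)
  interpret m2: coordinate_metric V2 m2 by (rule m2)
  have x1: "x \<in> V1" and x2: "\<phi> x \<in> V2" using W x by auto
  have DJ: "(\<phi> has_derivative J y) (at y)" if "y \<in> W" for y
    using smooth_on_has_derivative[OF sm that] by (simp add: J)
  have smJ: "smooth_on (\<lambda>y. J y v) W" for v
    using smooth_on_frechet_derivative[OF sm] by (simp add: J)
  have DH: "((\<lambda>y. J y v) has_derivative (\<lambda>u. H y u v)) (at y)" if "y \<in> W" for y v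
    using smooth_on_has_derivative[OF smJ that] by (simp add: H)
  have "continuous_on W (\<lambda>y. H y u v)" for u v
    using smooth_on_continuous_on[OF smooth_on_frechet_derivative[OF smJ]] by (simp add: H)
  then have Hsym: "H x u v = H x v u" for u v
    using symmetric_second_derivative[OF W(1) x DJ, of "\<lambda>y v u. H y u v"] DH by blast
  have D: "m1.Dm x u v w = m2.Dm (\<phi> x) (J x u) (J x v) (J x w)
      + m2 (\<phi> x) (H x u v) (J x w) + m2 (\<phi> x) (J x v) (H x u w)" for u v w
  proof -
    have "((\<lambda>s. m2 (\<phi> (x + s *\<^sub>R u)) (J (x + s *\<^sub>R u) v) (J (x + s *\<^sub>R u) w)) has_vector_derivative
        m2.Dm (\<phi> x) (J x u) (J x v) (J x w)
      + m2 (\<phi> x) (H x u v) (J x w) + m2 (\<phi> x) (J x v) (H x u w)) (at 0)"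
      using m2.m_product_rule[of 0 UNIV "\<lambda>s. \<phi> (x + s *\<^sub>R u)", OF _ _
          has_derivative_along_line[OF DJ[OF x]] has_derivative_along_line[OF DH[OF x]]
          has_derivative_along_line[OF DH[OF x]]] x2
      by simp
    then have "((\<lambda>s. m1 (x + s *\<^sub>R u) v w) has_vector_derivative
        m2.Dm (\<phi> x) (J x u) (J x v) (J x w)
      + m2 (\<phi> x) (H x u v) (J x w) + m2 (\<phi> x) (J x v) (H x u w)) (at 0)"
    proof (rule has_vector_derivative_transform_within_open)
      show "open ((\<lambda>s. x + s *\<^sub>R u) -` W)"
        by (intro open_vimage W continuous_intros)
    qed (use x pull in auto)
    from vector_derivative_unique_at[OF has_derivative_along_line[OF m1.has_derivative_m[OF x1]] this]
    show ?thesis .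
  qed
  have "2 * m2 (\<phi> x) (J x (m1.\<Gamma> x u v) - H x u v) z
      = m2.Dm (\<phi> x) (J x u) (J x v) z + m2.Dm (\<phi> x) (J x v) (J x u) z
        - m2.Dm (\<phi> x) z (J x u) (J x v)" for z
  proof -
    obtain w where w: "z = J x w" using surj by (metis surjD)
    show ?thesis
    proof -
      have "2 * m2 (\<phi> x) (J x (m1.\<Gamma> x u v)) (J x w)
          = m2.Dm (\<phi> x) (J x u) (J x v) (J x w) + m2.Dm (\<phi> x) (J x v) (J x u) (J x w)
          - m2.Dm (\<phi> x) (J x w) (J x u) (J x v) + 2 * m2 (\<phi> x) (H x u v) (J x w)"
        using m1.koszul[OF x1, of u v w]
        unfolding pull[OF x] D Hsym[of v u] Hsym[of w u] Hsym[of w v]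
          m2.sym[OF x2, of "H x u w" "J x v"]
        by linarith
      then show ?thesis
        unfolding w bilinear_lsub[OF m2.bilin[OF x2]] right_diff_distrib by linarith
    qed
  qed
  from m2.\<Gamma>_eqI[OF x2 this] show ?thesis by simp
qed

section \<open>Charts and components\<close>

context riemannian_manifold
begin

lemma chart_at_mem: "chart_at A p \<in> A" "p \<in> fst (chart_at A p)"
proof -
  have "\<exists>c. c \<in> A \<and> p \<in> fst c" using atlas unfolding smooth_atlas_def by blast
  from someI_ex[OF this] show "chart_at A p \<in> A" "p \<in> fst (chart_at A p)"
    by (simp_all add: chart_at_def)
qed

lemma open_chart: "c \<in> A \<Longrightarrow> open (fst c)" and open_chart_image: "c \<in> A \<Longrightarrow> open (snd c ` fst c)"
  and chart_homeomorphism: "c \<in> A \<Longrightarrow> homeomorphism (fst c) (snd c ` fst c) (snd c) (chart_inv c)"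
  using atlas unfolding smooth_atlas_def by blast+

lemma chart_inv_snd: "c \<in> A \<Longrightarrow> p \<in> fst c \<Longrightarrow> chart_inv c (snd c p) = p"
  using chart_homeomorphism homeomorphism_apply1 by metis

lemma open_overlap:
  assumes c: "c \<in> A" "c' \<in> A"
  shows "open (snd c ` (fst c \<inter> fst c'))"
proof -
  have "openin (top_of_set (fst c)) (fst c \<inter> fst c')"
    using open_chart[OF c(2)] by blast
  from homeomorphism_imp_open_map[OF chart_homeomorphism[OF c(1)] this]
  show ?thesis using openin_open_eq[OF open_chart_image[OF c(1)]] by blast
qed

lemma smooth_transition:
  "c \<in> A \<Longrightarrow> c' \<in> A \<Longrightarrow> smooth_on (snd c' \<circ> chart_inv c) (snd c ` (fst c \<inter> fst c'))"
  using atlas unfolding smooth_atlas_def by blast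

lemma transition_has_derivative:
  assumes "c \<in> A" "c' \<in> A" "p \<in> fst c" "p \<in> fst c'"
  shows "(snd c' \<circ> chart_inv c has_derivative change_comps c c' p) (at (snd c p))"
  unfolding change_comps_def
  by (rule smooth_on_has_derivative[OF smooth_transition]) (use assms in auto)

lemma linear_change_comps:
  assumes "c \<in> A" "c' \<in> A" "p \<in> fst c" "p \<in> fst c'"
  shows "linear (change_comps c c' p)"
  using has_derivative_linear[OF transition_has_derivative[OF assms]] .

text \<open>A formula for the transition map that holds near \<open>p\<close> determines the change of components at \<open>p\<close>.\<close>

lemma change_comps_eqI:
  assumes c: "c \<in> A" "c' \<in> A" "p \<in> fst c" "p \<in> fst c'"
    and D: "(f has_derivative D) (at (snd c p))"
    and W: "open W" "p \<in> W" "\<And>q. q \<in> W \<Longrightarrow> q \<in> fst c \<Longrightarrow> q \<in> fst c' \<Longrightarrow> f (snd c q) = snd c' q"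
  shows "change_comps c c' p = D"
proof -
  have "openin (top_of_set (fst c)) (fst c \<inter> (fst c' \<inter> W))"
    using open_chart[OF c(2)] W(1) by blast
  from homeomorphism_imp_open_map[OF chart_homeomorphism[OF c(1)] this]
  have op: "open (snd c ` (fst c \<inter> (fst c' \<inter> W)))"
    using openin_open_eq[OF open_chart_image[OF c(1)]] by blast
  have "(snd c' \<circ> chart_inv c has_derivative D) (at (snd c p))"
    by (rule has_derivative_transform_within_open[OF D op])
      (use c W in \<open>auto simp: chart_inv_snd\<close>)
  with transition_has_derivative[OF c] show ?thesis by (rule has_derivative_unique)
qed

lemma change_comps_refl:
  assumes "c \<in> A" "p \<in> fst c"
  shows "change_comps c c p u = u"
proof -
  have "change_comps c c p = (\<lambda>u. u)"
    by (rule change_comps_eqI[OF assms(1,1) assms(2,2) has_derivative_ident, of UNIV]) simp_all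
  then show ?thesis by simp
qed

lemma change_comps_change_comps:
  assumes c: "c \<in> A" "c' \<in> A" "c'' \<in> A" "p \<in> fst c" "p \<in> fst c'" "p \<in> fst c''"
  shows "change_comps c' c'' p (change_comps c c' p u) = change_comps c c'' p u"
proof -
  have eq: "(snd c' \<circ> chart_inv c) (snd c p) = snd c' p"
    using c by (simp add: chart_inv_snd)
  have "((snd c'' \<circ> chart_inv c') \<circ> (snd c' \<circ> chart_inv c) has_derivative
      change_comps c' c'' p \<circ> change_comps c c' p) (at (snd c p))"
    by (intro diff_chain_at transition_has_derivative c)
      (simp only: eq transition_has_derivative[OF c(2,3,5,6)])
  then have "change_comps c c'' p = change_comps c' c'' p \<circ> change_comps c c' p"
    by (rule change_comps_eqI[OF c(1,3,4,6) _ open_chart[OF c(2)] c(5)])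
      (use c in \<open>simp add: chart_inv_snd\<close>)
  then show ?thesis by simp
qed

lemma surj_change_comps:
  assumes "c \<in> A" "c' \<in> A" "p \<in> fst c" "p \<in> fst c'"
  shows "surj (change_comps c c' p)"
  using change_comps_change_comps[of c' c c' p] change_comps_refl[of c' p] assms
  by (metis surjI)

lemma comps_of_comps: "c \<in> A \<Longrightarrow> p \<in> fst c \<Longrightarrow> comps A c p (of_comps A c p u) = u"
  unfolding comps_def of_comps_def
  by (simp add: change_comps_change_comps change_comps_refl chart_at_mem)

lemma of_comps_comps: "c \<in> A \<Longrightarrow> p \<in> fst c \<Longrightarrow> of_comps A c p (comps A c p u) = u"
  unfolding comps_def of_comps_def
  by (simp add: change_comps_change_comps change_comps_refl chart_at_mem)

lemma change_comps_comps:
  assumes "c \<in> A" "c' \<in> A" "p \<in> fst c" "p \<in> fst c'"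
  shows "change_comps c c' p (comps A c p u) = comps A c' p u"
  unfolding comps_def using assms by (simp add: change_comps_change_comps chart_at_mem)

lemma of_comps_change_comps:
  assumes "c \<in> A" "c' \<in> A" "p \<in> fst c" "p \<in> fst c'"
  shows "of_comps A c' p (change_comps c c' p u) = of_comps A c p u"
  unfolding of_comps_def using assms by (simp add: change_comps_change_comps chart_at_mem)

lemma linear_of_comps: "c \<in> A \<Longrightarrow> p \<in> fst c \<Longrightarrow> linear (of_comps A c p)"
  unfolding of_comps_def by (intro linear_change_comps chart_at_mem)

lemma metric_in_chart_at:
  "c \<in> A \<Longrightarrow> p \<in> fst c \<Longrightarrow>
    metric_in_chart A g c (snd c p) u v = g p (of_comps A c p u) (of_comps A c p v)"
  by (simp add: metric_in_chart_def chart_inv_snd)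

lemma metric_in_chart_comps:
  "c \<in> A \<Longrightarrow> p \<in> fst c \<Longrightarrow>
    metric_in_chart A g c (snd c p) (comps A c p u) (comps A c p v) = g p u v"
  by (simp add: metric_in_chart_at of_comps_comps)

lemma coordinate_metric_chart:
  assumes c: "c \<in> A"
  shows "coordinate_metric (snd c ` fst c) (metric_in_chart A g c)"
proof
  show "open (snd c ` fst c)" by (rule open_chart_image[OF c])
  show "smooth_on (\<lambda>x. metric_in_chart A g c x u v) (snd c ` fst c)" for u v
    by (rule metric_smooth[OF c])
  fix x u v assume "x \<in> snd c ` fst c"
  then obtain p where p: "p \<in> fst c" and x: "x = snd c p" by blast
  have lin: "linear (of_comps A c p)" by (rule linear_of_comps[OF c p])
  have "linear (\<lambda>v. g p (of_comps A c p u) (of_comps A c p v))"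
    "linear (\<lambda>u. g p (of_comps A c p u) (of_comps A c p v))" for u v
    using linear_compose[OF lin, of "g p (of_comps A c p u)"]
      linear_compose[OF lin, of "\<lambda>u. g p u (of_comps A c p v)"] metric_bilinear[of p]
    by (simp_all add: bilinear_def o_def)
  then show "bilinear (metric_in_chart A g c x)"
    by (simp add: bilinear_def x metric_in_chart_at[OF c p])
  show "metric_in_chart A g c x u v = metric_in_chart A g c x v u"
    by (simp add: x metric_in_chart_at[OF c p] metric_sym[of p])
  assume "u \<noteq> 0"
  then have "of_comps A c p u \<noteq> 0"
    using comps_of_comps[OF c p, of u] linear_0[OF lin] comps_of_comps[OF c p, of 0] by metis
  then show "metric_in_chart A g c x u u > 0"
    by (simp add: x metric_in_chart_at[OF c p] metric_pos)
qed

lemma christoffel_change: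
  assumes c: "c \<in> A" "c' \<in> A" "p \<in> fst c" "p \<in> fst c'"
  shows "change_comps c c' p (christoffel A g c (snd c p) u v) =
    frechet_derivative (\<lambda>y. frechet_derivative (snd c' \<circ> chart_inv c) (at y) v) (at (snd c p)) u
    + christoffel A g c' (snd c' p) (change_comps c c' p u) (change_comps c c' p v)"
proof -
  define J where "J = (\<lambda>x. frechet_derivative (snd c' \<circ> chart_inv c) (at x))"
  have J: "J (snd c q) = change_comps c c' q" for q
    by (simp add: J_def change_comps_def fun_eq_iff)
  have "J (snd c p) (christoffel_map (metric_in_chart A g c) (snd c p) u v)
      = frechet_derivative (\<lambda>y. J y v) (at (snd c p)) u
        + christoffel_map (metric_in_chart A g c') ((snd c' \<circ> chart_inv c) (snd c p))
            (J (snd c p) u) (J (snd c p) v)"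
  proof (rule christoffel_transformation[OF coordinate_metric_chart[OF c(1)]
        coordinate_metric_chart[OF c(2)] open_overlap[OF c(1,2)] _ _ smooth_transition[OF c(1,2)]
        J_def refl])
    show "snd c ` (fst c \<inter> fst c') \<subseteq> snd c ` fst c" by blast
    show "(snd c' \<circ> chart_inv c) ` snd c ` (fst c \<inter> fst c') \<subseteq> snd c' ` fst c'"
      using c by (auto simp: chart_inv_snd)
    show "snd c p \<in> snd c ` (fst c \<inter> fst c')" using c by blast
    show "surj (J (snd c p))" using surj_change_comps[OF c] by (simp add: J)
    fix x u v assume "x \<in> snd c ` (fst c \<inter> fst c')"
    then obtain q where q: "q \<in> fst c" "q \<in> fst c'" and x: "x = snd c q" by blast
    show "metric_in_chart A g c x u v
        = metric_in_chart A g c' ((snd c' \<circ> chart_inv c) x) (J x u) (J x v)"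
      using c q by (simp add: x J chart_inv_snd metric_in_chart_at of_comps_change_comps)
  qed
  then show ?thesis
    using c by (simp add: J christoffel_eq chart_inv_snd) (simp add: J_def)
qed

end

section \<open>Curves and geodesics\<close>

text \<open>Geodesics are taken on the whole real line and restricted to intervals afterwards, so that velocities
are two-sided derivatives; by \<open>chart_velocity_Icc\<close> the one-sided velocities on an interval agree with
them.\<close>

context riemannian_manifold
begin

lemma eventually_curve_in:
  fixes \<gamma> :: "real \<Rightarrow> 'm"
  assumes "continuous_on UNIV \<gamma>" and "open U" and "\<gamma> t \<in> U"
  shows "\<forall>\<^sub>F s in at t within I. \<gamma> s \<in> U"
proof -
  have "isCont \<gamma> t" using assms(1) by (simp add: continuous_on_eq_continuous_at)
  then have "(\<gamma> \<longlongrightarrow> \<gamma> t) (at t within I)"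
    unfolding isCont_def by (rule tendsto_within_subset) simp
  then show ?thesis using assms(2,3) by (rule topological_tendstoD)
qed

lemma has_chart_velocity:
  assumes "C1_curve A UNIV \<gamma>" and "c \<in> A" and "\<gamma> t \<in> fst c"
  shows "(snd c \<circ> \<gamma> has_vector_derivative chart_velocity c UNIV \<gamma> t) (at t within I)"
proof -
  have "(snd c \<circ> \<gamma>) differentiable at t"
    using assms unfolding C1_curve_def by blast
  then have "(snd c \<circ> \<gamma> has_vector_derivative chart_velocity c UNIV \<gamma> t) (at t)"
    using vector_derivative_works by (auto simp: chart_velocity_def)
  then show ?thesis by (rule has_vector_derivative_at_within)
qed

lemma chart_velocity_Icc:
  assumes "C1_curve A UNIV \<gamma>" and "c \<in> A" and "\<gamma> t \<in> fst c" and "a < b" and "t \<in> {a..b}"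
  shows "chart_velocity c {a..b} \<gamma> t = chart_velocity c UNIV \<gamma> t"
  using vector_derivative_within_closed_interval[OF assms(4,5) has_chart_velocity[OF assms(1-3)]]
  by (simp add: chart_velocity_def)

lemma velocity_Icc:
  assumes "C1_curve A UNIV \<gamma>" and "a < b" and "t \<in> {a..b}"
  shows "velocity A {a..b} \<gamma> t = velocity A UNIV \<gamma> t"
  unfolding velocity_def using assms by (intro chart_velocity_Icc chart_at_mem)

lemma change_comps_chart_velocity:
  assumes \<gamma>: "C1_curve A UNIV \<gamma>" and c: "c \<in> A" "c' \<in> A" "\<gamma> t \<in> fst c" "\<gamma> t \<in> fst c'"
  shows "change_comps c c' (\<gamma> t) (chart_velocity c UNIV \<gamma> t) = chart_velocity c' UNIV \<gamma> t"
proof -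
  have cont: "continuous_on UNIV \<gamma>" using \<gamma> by (simp add: C1_curve_def)
  have "(snd c' \<circ> chart_inv c has_derivative change_comps c c' (\<gamma> t))
      (at ((snd c \<circ> \<gamma>) t) within range (snd c \<circ> \<gamma>))"
    using transition_has_derivative[OF c] by (simp add: has_derivative_at_withinI)
  from vector_derivative_diff_chain_within[OF has_chart_velocity[OF \<gamma> c(1,3)] this]
  have "((snd c' \<circ> chart_inv c) \<circ> (snd c \<circ> \<gamma>) has_vector_derivative
      change_comps c c' (\<gamma> t) (chart_velocity c UNIV \<gamma> t)) (at t)" .
  then have "(snd c' \<circ> \<gamma> has_vector_derivative
      change_comps c c' (\<gamma> t) (chart_velocity c UNIV \<gamma> t)) (at t)"
    by (rule has_vector_derivative_transform_within_open[where S = "\<gamma> -` fst c"])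
      (use c in \<open>auto simp: chart_inv_snd intro: open_vimage open_chart cont\<close>)
  then show ?thesis
    using has_chart_velocity[OF \<gamma> c(2,4), of UNIV] vector_derivative_unique_at by blast
qed

lemma C1_curve_Icc:
  assumes \<gamma>: "C1_curve A UNIV \<gamma>" and "a < b"
  shows "C1_curve A {a..b} \<gamma>"
  unfolding C1_curve_def
proof (intro conjI ballI impI)
  show "continuous_on {a..b} \<gamma>" using \<gamma> continuous_on_subset unfolding C1_curve_def by blast
  fix c assume c: "c \<in> A"
  show "(snd c \<circ> \<gamma>) differentiable (at t within {a..b})" if "t \<in> {a..b}" "\<gamma> t \<in> fst c" for t
    using has_chart_velocity[OF \<gamma> c that(2)] differentiableI_vector by blast
  have "continuous_on {t \<in> UNIV. \<gamma> t \<in> fst c} (chart_velocity c UNIV \<gamma>)"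
    using \<gamma> c unfolding C1_curve_def by blast
  then have "continuous_on {t \<in> {a..b}. \<gamma> t \<in> fst c} (chart_velocity c UNIV \<gamma>)"
    by (rule continuous_on_subset) auto
  then show "continuous_on {t \<in> {a..b}. \<gamma> t \<in> fst c} (chart_velocity c {a..b} \<gamma>)"
    by (rule continuous_on_eq) (use assms c in \<open>simp add: chart_velocity_Icc\<close>)
qed

lemma geodesic_Icc:
  assumes \<gamma>: "geodesic A g UNIV \<gamma>" and ab: "a < b"
  shows "geodesic A g {a..b} \<gamma>"
  unfolding geodesic_def parallel_along_def
proof (intro conjI ballI impI)
  have C1: "C1_curve A UNIV \<gamma>" using \<gamma> by (simp add: geodesic_def)
  then show "C1_curve A {a..b} \<gamma>" using ab by (rule C1_curve_Icc)
  fix t c assume t: "t \<in> {a..b}" and c: "c \<in> A" and tc: "\<gamma> t \<in> fst c"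
  have "((\<lambda>s. comps A c (\<gamma> s) (velocity A UNIV \<gamma> s)) has_vector_derivative
      - christoffel A g c (snd c (\<gamma> t)) (chart_velocity c UNIV \<gamma> t)
          (comps A c (\<gamma> t) (velocity A UNIV \<gamma> t))) (at t within {a..b})"
    using conjunct2[OF \<gamma>[unfolded geodesic_def parallel_along_def], rule_format, OF UNIV_I c tc]
    by (rule has_vector_derivative_at_within)
  then show "((\<lambda>s. comps A c (\<gamma> s) (velocity A {a..b} \<gamma> s)) has_vector_derivative
      - christoffel A g c (snd c (\<gamma> t)) (chart_velocity c {a..b} \<gamma> t)
          (comps A c (\<gamma> t) (velocity A {a..b} \<gamma> t))) (at t within {a..b})"
    unfolding velocity_Icc[OF C1 ab t] chart_velocity_Icc[OF C1 c tc ab t]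
    by (rule has_vector_derivative_transform[OF t, rotated]) (simp add: velocity_Icc[OF C1 ab])
qed

end

section \<open>Parallel transport\<close>

context riemannian_manifold
begin

text \<open>The equation of parallel transport need only be checked in one chart. The second derivative of the
transition map that arises when the components are differentiated cancels against the one in
\<open>christoffel_change\<close>.\<close>

lemma parallel_chart_independent:
  assumes \<gamma>: "C1_curve A UNIV \<gamma>" and t: "t \<in> I"
    and c: "c \<in> A" "c' \<in> A" "\<gamma> t \<in> fst c" "\<gamma> t \<in> fst c'"
    and X: "((\<lambda>s. comps A c (\<gamma> s) (X s)) has_vector_derivative
      - christoffel A g c (snd c (\<gamma> t)) (chart_velocity c UNIV \<gamma> t) (comps A c (\<gamma> t) (X t)))
      (at t within I)"
  shows "((\<lambda>s. comps A c' (\<gamma> s) (X s)) has_vector_derivative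
      - christoffel A g c' (snd c' (\<gamma> t)) (chart_velocity c' UNIV \<gamma> t) (comps A c' (\<gamma> t) (X t)))
      (at t within I)"
proof -
  have cont: "continuous_on UNIV \<gamma>" using \<gamma> by (simp add: C1_curve_def)
  interpret m: coordinate_metric "snd c ` fst c" "metric_in_chart A g c"
    by (rule coordinate_metric_chart[OF c(1)])
  interpret m': coordinate_metric "snd c' ` fst c'" "metric_in_chart A g c'"
    by (rule coordinate_metric_chart[OF c(2)])
  have mem: "snd c (\<gamma> t) \<in> snd c ` fst c" "snd c' (\<gamma> t) \<in> snd c' ` fst c'" using c by auto
  define J where "J = (\<lambda>x. frechet_derivative (snd c' \<circ> chart_inv c) (at x))"
  have J: "J (snd c q) = change_comps c c' q" for q
    by (simp add: J_def change_comps_def fun_eq_iff)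
  define F' where
    "F' v = frechet_derivative (\<lambda>y. J y v) (at (snd c (\<gamma> t))) (chart_velocity c UNIV \<gamma> t)" for v
  define V V' where "V = chart_velocity c UNIV \<gamma> t" and "V' = chart_velocity c' UNIV \<gamma> t"
  have F'_eq: "F' v = change_comps c c' (\<gamma> t) (m.\<Gamma> (snd c (\<gamma> t)) V v)
      - m'.\<Gamma> (snd c' (\<gamma> t)) V' (change_comps c c' (\<gamma> t) v)" for v
    using christoffel_change[OF c, of V v] change_comps_chart_velocity[OF \<gamma> c]
    by (simp add: F'_def J_def V_def V'_def christoffel_eq)
  have linJ: "linear (change_comps c c' (\<gamma> t))" by (rule linear_change_comps[OF c])
  have linF': "linear F'"
    unfolding F'_eq[abs_def]
    using linear_compose[OF m.linear_\<Gamma>(1)[OF mem(1)] linJ] linear_compose[OF linJ m'.linear_\<Gamma>(1)[OF mem(2)]]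
    by (intro linear_compose_sub) (simp_all add: o_def)
  have ev: "\<forall>\<^sub>F s in at t within I. \<gamma> s \<in> fst c \<inter> fst c'"
    by (rule eventually_curve_in[OF cont open_Int[OF open_chart[OF c(1)] open_chart[OF c(2)]]])
      (use c in simp)
  have DF: "((\<lambda>s. J (snd c (\<gamma> s)) v) has_vector_derivative F' v) (at t within I)" for v
  proof -
    have "((\<lambda>y. J y v) has_derivative frechet_derivative (\<lambda>y. J y v) (at (snd c (\<gamma> t))))
        (at (snd c (\<gamma> t)))"
      unfolding J_def
      by (rule smooth_on_has_derivative[OF smooth_on_frechet_derivative[OF smooth_transition[OF c(1,2)]]])
        (use c in auto)
    then have "((\<lambda>y. J y v) has_derivative frechet_derivative (\<lambda>y. J y v) (at (snd c (\<gamma> t))))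
        (at ((snd c \<circ> \<gamma>) t) within (snd c \<circ> \<gamma>) ` I)"
      by (auto intro: has_derivative_at_withinI)
    from vector_derivative_diff_chain_within[OF has_chart_velocity[OF \<gamma> c(1,3)] this]
    show ?thesis by (simp add: o_def F'_def)
  qed
  have "((\<lambda>s. J (snd c (\<gamma> s)) (comps A c (\<gamma> s) (X s))) has_vector_derivative
      F' (comps A c (\<gamma> t) (X t))
      + J (snd c (\<gamma> t)) (- christoffel A g c (snd c (\<gamma> t)) V (comps A c (\<gamma> t) (X t))))
      (at t within I)"
  proof (rule has_vector_derivative_linear_apply[OF t _ _ linF' DF])
    show "\<forall>\<^sub>F s in at t within I. linear (J (snd c (\<gamma> s)))"
      using ev by eventually_elim (use c in \<open>auto simp: J linear_change_comps\<close>)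
    show "linear (J (snd c (\<gamma> t)))" by (simp add: J linJ)
  qed (use X in \<open>simp add: V_def\<close>)
  also have "F' (comps A c (\<gamma> t) (X t))
      + J (snd c (\<gamma> t)) (- christoffel A g c (snd c (\<gamma> t)) V (comps A c (\<gamma> t) (X t)))
      = - christoffel A g c' (snd c' (\<gamma> t)) V' (comps A c' (\<gamma> t) (X t))"
    using c by (simp add: F'_eq J linear_neg[OF linJ] christoffel_eq change_comps_comps)
  finally have D: "((\<lambda>s. J (snd c (\<gamma> s)) (comps A c (\<gamma> s) (X s))) has_vector_derivative
      - christoffel A g c' (snd c' (\<gamma> t)) V' (comps A c' (\<gamma> t) (X t))) (at t within I)" .
  have "\<forall>\<^sub>F s in at t within I.
      J (snd c (\<gamma> s)) (comps A c (\<gamma> s) (X s)) = comps A c' (\<gamma> s) (X s)"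
    using ev by eventually_elim (use c in \<open>auto simp: J change_comps_comps\<close>)
  from has_derivative_transform_eventually[OF D[unfolded has_vector_derivative_def] this _ t]
  show ?thesis
    using c by (simp add: J change_comps_comps has_vector_derivative_def V'_def)
qed

lemma parallel_along_Icc_iff:
  assumes "C1_curve A UNIV \<gamma>" "a < b"
  shows "parallel_along A g {a..b} \<gamma> X \<longleftrightarrow>
    (\<forall>t\<in>{a..b}. \<forall>c\<in>A. \<gamma> t \<in> fst c \<longrightarrow>
        ((\<lambda>s. comps A c (\<gamma> s) (X s)) has_vector_derivative
          - christoffel A g c (snd c (\<gamma> t)) (chart_velocity c UNIV \<gamma> t) (comps A c (\<gamma> t) (X t)))
        (at t within {a..b}))"
  unfolding parallel_along_def using chart_velocity_Icc[OF assms(1) _ _ assms(2)] by auto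

text \<open>Inside one chart, the equation of parallel transport is a linear differential equation with
continuous coefficients.\<close>

lemma parallel_exists_in_chart:
  assumes \<gamma>: "C1_curve A UNIV \<gamma>" and ab: "a < b" and c: "c \<in> A" and sub: "\<gamma> ` {a..b} \<subseteq> fst c"
  shows "\<exists>X. parallel_along A g {a..b} \<gamma> X \<and> X a = u"
proof -
  have in_c: "\<gamma> t \<in> fst c" if "t \<in> {a..b}" for t using sub that by blast
  interpret m: coordinate_metric "snd c ` fst c" "metric_in_chart A g c"
    by (rule coordinate_metric_chart[OF c])
  define M where "M t v = - m.\<Gamma> (snd c (\<gamma> t)) (chart_velocity c UNIV \<gamma> t) v" for t v
  have "\<exists>Z. Z a = comps A c (\<gamma> a) u \<and>
      (\<forall>t\<in>{a..b}. (Z has_vector_derivative M t (Z t)) (at t within {a..b}))"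
  proof (rule linear_ode_exists[OF ab])
    show "linear (M t)" if "t \<in> {a..b}" for t
      unfolding M_def using in_c[OF that] by (intro linear_compose_neg m.linear_\<Gamma>) blast
    have "continuous_on {t \<in> UNIV. \<gamma> t \<in> fst c} (chart_velocity c UNIV \<gamma>)"
      using \<gamma> c unfolding C1_curve_def by blast
    then have V: "continuous_on {a..b} (chart_velocity c UNIV \<gamma>)"
      by (rule continuous_on_subset) (use in_c in auto)
    have "continuous_on {a..b} (snd c \<circ> \<gamma>)"
      using has_chart_velocity[OF \<gamma> c in_c] has_vector_derivative_continuous
      by (metis continuous_on_eq_continuous_within)
    then have y: "continuous_on {a..b} (\<lambda>t. snd c (\<gamma> t))" by (simp add: o_def)
    show "continuous_on {a..b} (\<lambda>t. M t v)" for v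
      unfolding M_def using in_c by (intro continuous_on_minus m.continuous_on_\<Gamma> y V) blast
  qed
  then obtain Z where Za: "Z a = comps A c (\<gamma> a) u"
    and Z: "\<And>t. t \<in> {a..b} \<Longrightarrow> (Z has_vector_derivative M t (Z t)) (at t within {a..b})"
    by blast
  define X where "X t = of_comps A c (\<gamma> t) (Z t)" for t
  have XZ: "comps A c (\<gamma> t) (X t) = Z t" if "t \<in> {a..b}" for t
    using in_c[OF that] c by (simp add: X_def comps_of_comps)
  have "parallel_along A g {a..b} \<gamma> X"
    unfolding parallel_along_Icc_iff[OF \<gamma> ab]
  proof (intro ballI impI)
    fix t c' assume t: "t \<in> {a..b}" and c': "c' \<in> A" "\<gamma> t \<in> fst c'"
    have "((\<lambda>s. comps A c (\<gamma> s) (X s)) has_vector_derivative M t (Z t)) (at t within {a..b})"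
      by (rule has_vector_derivative_transform[OF t XZ Z[OF t]])
    then show "((\<lambda>s. comps A c' (\<gamma> s) (X s)) has_vector_derivative
          - christoffel A g c' (snd c' (\<gamma> t)) (chart_velocity c' UNIV \<gamma> t) (comps A c' (\<gamma> t) (X t)))
        (at t within {a..b})"
      by (intro parallel_chart_independent[OF \<gamma> t c c'(1) in_c[OF t] c'(2)])
        (simp add: M_def XZ[OF t] christoffel_eq)
  qed
  moreover have "X a = u" using in_c[of a] ab c by (simp add: X_def Za of_comps_comps)
  ultimately show ?thesis by blast
qed

lemma parallel_join:
  assumes \<gamma>: "C1_curve A UNIV \<gamma>" and ab: "a < b" and bd: "b < d"
    and X: "parallel_along A g {a..b} \<gamma> X" and Y: "parallel_along A g {b..d} \<gamma> Y"
    and XY: "X b = Y b"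
  shows "parallel_along A g {a..d} \<gamma> (\<lambda>t. if t \<in> {a..b} then X t else Y t)"
  unfolding parallel_along_Icc_iff[OF \<gamma> less_trans[OF ab bd]]
proof (intro ballI impI)
  fix t c assume t: "t \<in> {a..d}" and c: "c \<in> A" "\<gamma> t \<in> fst c"
  have cl: "closure {a..b} \<inter> closure {b..d} = {b}" using ab bd by auto
  define D where "D X t = - christoffel A g c (snd c (\<gamma> t)) (chart_velocity c UNIV \<gamma> t)
      (comps A c (\<gamma> t) (X t))" for X t
  have "((\<lambda>s. if s \<in> {a..b} then comps A c (\<gamma> s) (X s) else comps A c (\<gamma> s) (Y s))
      has_vector_derivative (if t \<in> {a..b} then D X t else D Y t)) (at t within {a..d})"
  proof (rule has_vector_derivative_If_within_closures[where T = "{b..d}" and f' = "D X" and g' = "D Y"])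
    show "t \<in> {a..b} \<union> {b..d}" "{a..d} = {a..b} \<union> {b..d}" using t ab bd by auto
    have un: "{a..b} \<union> {b} = {a..b}" "{b..d} \<union> {b} = {b..d}" using ab bd by auto
    show "((\<lambda>s. comps A c (\<gamma> s) (X s)) has_vector_derivative D X t)
        (at t within {a..b} \<union> (closure {a..b} \<inter> closure {b..d}))"
      if "t \<in> {a..b} \<union> (closure {a..b} \<inter> closure {b..d})"
      using X that c unfolding cl un parallel_along_Icc_iff[OF \<gamma> ab] D_def by blast
    show "((\<lambda>s. comps A c (\<gamma> s) (Y s)) has_vector_derivative D Y t)
        (at t within {b..d} \<union> (closure {a..b} \<inter> closure {b..d}))"
      if "t \<in> {b..d} \<union> (closure {a..b} \<inter> closure {b..d})"
      using Y that c unfolding cl un parallel_along_Icc_iff[OF \<gamma> bd] D_def by blast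
    show "comps A c (\<gamma> t) (X t) = comps A c (\<gamma> t) (Y t)" "D X t = D Y t"
      if "t \<in> closure {a..b}" "t \<in> closure {b..d}"
    proof -
      have "t = b" using that cl by blast
      then show "comps A c (\<gamma> t) (X t) = comps A c (\<gamma> t) (Y t)" "D X t = D Y t"
        using XY by (simp_all add: D_def)
    qed
  qed
  moreover have "(\<lambda>s. if s \<in> {a..b} then comps A c (\<gamma> s) (X s) else comps A c (\<gamma> s) (Y s))
      = (\<lambda>s. comps A c (\<gamma> s) (if s \<in> {a..b} then X s else Y s))" by auto
  moreover have "(if t \<in> {a..b} then D X t else D Y t)
      = D (\<lambda>t. if t \<in> {a..b} then X t else Y t) t" by (simp add: D_def)
  ultimately show "((\<lambda>s. comps A c (\<gamma> s) (if s \<in> {a..b} then X s else Y s)) has_vector_derivative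
          - christoffel A g c (snd c (\<gamma> t)) (chart_velocity c UNIV \<gamma> t)
            (comps A c (\<gamma> t) (if t \<in> {a..b} then X t else Y t)))
        (at t within {a..d})"
    by (simp only: D_def)
qed

text \<open>Parallel fields on short intervals, each inside one chart, are joined by the bisection principle
\<open>Bolzano\<close>.\<close>

lemma parallel_exists:
  assumes \<gamma>: "C1_curve A UNIV \<gamma>" and ab: "a < b"
  shows "\<exists>X. parallel_along A g {a..b} \<gamma> X \<and> X a = u"
proof -
  have cont: "continuous_on UNIV \<gamma>" using \<gamma> by (simp add: C1_curve_def)
  define P where
    "P s t \<longleftrightarrow> (s < t \<longrightarrow> (\<forall>u. \<exists>X. parallel_along A g {s..t} \<gamma> X \<and> X s = u))" for s t
  have "P a b"
  proof (rule Bolzano)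
    show "a \<le> b" using ab by simp
    fix r s t assume rs: "P r s" and st: "P s t" and le: "r \<le> s" "s \<le> t"
    show "P r t"
    proof (cases "r = s \<or> s = t")
      case False
      then have lt: "r < s" "s < t" using le by auto
      show ?thesis
        unfolding P_def
      proof (intro impI allI)
        fix u
        obtain X where X: "parallel_along A g {r..s} \<gamma> X" "X r = u"
          using rs lt unfolding P_def by blast
        obtain Y where Y: "parallel_along A g {s..t} \<gamma> Y" "Y s = X s"
          using st lt unfolding P_def by blast
        from parallel_join[OF \<gamma> lt X(1) Y(1) Y(2)[symmetric]]
        show "\<exists>X. parallel_along A g {r..t} \<gamma> X \<and> X r = u"
          using X(2) lt by (intro exI[of _ "\<lambda>v. if v \<in> {r..s} then X v else Y v"]) auto
      qed
    qed (use rs st in auto)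
  next
    fix x
    define c where "c = chart_at A (\<gamma> x)"
    have c: "c \<in> A" "\<gamma> x \<in> fst c" by (simp_all add: c_def chart_at_mem)
    have "open (\<gamma> -` fst c)" using open_chart[OF c(1)] cont by (rule open_vimage)
    then obtain d where d: "d > 0" "ball x d \<subseteq> \<gamma> -` fst c"
      using c(2) openE by blast
    have "P s t" if "s \<le> x" "x \<le> t" "t - s < d" for s t
    proof -
      have "{s..t} \<subseteq> ball x d" using that by (auto simp: dist_real_def)
      then have "\<gamma> ` {s..t} \<subseteq> fst c" using d(2) by blast
      then show ?thesis unfolding P_def using parallel_exists_in_chart[OF \<gamma> _ c(1)] by blast
    qed
    then show "\<exists>d>0. \<forall>s t. s \<le> x \<and> x \<le> t \<and> t - s < d \<longrightarrow> P s t" using d(1) by blast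
  qed
  then show ?thesis using ab unfolding P_def by blast
qed

lemma parallel_isometry:
  assumes \<gamma>: "C1_curve A UNIV \<gamma>" and ab: "a < b"
    and X: "parallel_along A g {a..b} \<gamma> X" and Y: "parallel_along A g {a..b} \<gamma> Y"
    and t: "t \<in> {a..b}"
  shows "g (\<gamma> t) (X t) (Y t) = g (\<gamma> a) (X a) (Y a)"
proof -
  have cont: "continuous_on UNIV \<gamma>" using \<gamma> by (simp add: C1_curve_def)
  have "((\<lambda>s. g (\<gamma> s) (X s) (Y s)) has_derivative (\<lambda>h. 0)) (at t within {a..b})"
    if t: "t \<in> {a..b}" for t
  proof -
    define c where "c = chart_at A (\<gamma> t)"
    have c: "c \<in> A" "\<gamma> t \<in> fst c" by (simp_all add: c_def chart_at_mem)
    interpret m: coordinate_metric "snd c ` fst c" "metric_in_chart A g c"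
      by (rule coordinate_metric_chart[OF c(1)])
    \<comment> \<open>The inner product is computed in a chart around \<open>\<gamma> t\<close>; it agrees with \<open>g\<close> only while the curve stays there.\<close>
    have D: "((\<lambda>s. metric_in_chart A g c ((snd c \<circ> \<gamma>) s) (comps A c (\<gamma> s) (X s)) (comps A c (\<gamma> s) (Y s)))
        has_vector_derivative 0) (at t within {a..b})"
      using X Y t c unfolding parallel_along_Icc_iff[OF \<gamma> ab] christoffel_eq
      by (intro m.parallel_m_derivative[OF t _ has_chart_velocity[OF \<gamma> c]]) simp_all
    have "\<forall>\<^sub>F s in at t within {a..b}. \<gamma> s \<in> fst c"
      by (rule eventually_curve_in[OF cont open_chart[OF c(1)] c(2)])
    then have "\<forall>\<^sub>F s in at t within {a..b}.
        metric_in_chart A g c ((snd c \<circ> \<gamma>) s) (comps A c (\<gamma> s) (X s)) (comps A c (\<gamma> s) (Y s))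
        = g (\<gamma> s) (X s) (Y s)"
      by eventually_elim (simp add: metric_in_chart_comps c)
    from has_derivative_transform_eventually[OF D[unfolded has_vector_derivative_def] this _ t]
    show ?thesis using c by (simp add: metric_in_chart_comps)
  qed
  then have "\<exists>k. \<forall>s\<in>{a..b}. g (\<gamma> s) (X s) (Y s) = k"
    by (intro has_derivative_zero_constant) auto
  then show ?thesis using t ab by (metis atLeastAtMost_iff less_imp_le order_refl)
qed

text \<open>Uniqueness of parallel fields with a given initial vector follows from the isometry property: the
difference of two of them keeps norm zero.\<close>

lemma parallel_transport_eq:
  assumes \<gamma>: "C1_curve A UNIV \<gamma>" and ab: "a < b" and X: "parallel_along A g {a..b} \<gamma> X"
  shows "parallel_transport A g a b \<gamma> (X a) = X b"
  unfolding parallel_transport_def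
proof (rule the_equality)
  show "\<exists>Y. parallel_along A g {a..b} \<gamma> Y \<and> Y a = X a \<and> Y b = X b" using X by blast
  fix w assume "\<exists>Y. parallel_along A g {a..b} \<gamma> Y \<and> Y a = X a \<and> Y b = w"
  then obtain Y where Y: "parallel_along A g {a..b} \<gamma> Y" "Y a = X a" "Y b = w" by blast
  have b: "b \<in> {a..b}" using ab by simp
  note iso = parallel_isometry[OF \<gamma> ab _ _ b]
  have "g (\<gamma> b) (w - X b) (w - X b) = 0"
    using iso[OF X X] iso[OF X Y(1)] iso[OF Y(1) X] iso[OF Y(1) Y(1)] Y(2,3)
    by (simp add: bilinear_lsub[OF metric_bilinear] bilinear_rsub[OF metric_bilinear])
  then show "w = X b" using metric_pos[of "w - X b" "\<gamma> b"] by force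
qed

end

section \<open>The gradient and the descent inequality\<close>

context riemannian_manifold
begin

lemma gnorm_power2: "(gnorm g p u)\<^sup>2 = g p u u"
proof -
  have "g p u u \<ge> 0"
    using metric_pos[of u p] bilinear_lzero[OF metric_bilinear[of p], of u]
    by (cases "u = 0") (auto intro: less_imp_le)
  then show ?thesis by (simp add: gnorm_def)
qed

lemma gnorm_nonneg: "gnorm g p u \<ge> 0"
proof -
  have "g p u u \<ge> 0" using gnorm_power2[of p u] by (metis zero_le_power2)
  then show ?thesis by (simp add: gnorm_def)
qed

lemma gnorm_pos: "u \<noteq> 0 \<Longrightarrow> gnorm g p u > 0"
  using metric_pos[of u p] by (simp add: gnorm_def)

lemma gnorm_Cauchy_Schwarz: "g p u v \<le> gnorm g p u * gnorm g p v"
proof (cases "v = 0")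
  case True
  then show ?thesis using gnorm_nonneg by (simp add: bilinear_rzero[OF metric_bilinear])
next
  case False
  note b = bilinear_lsub[OF metric_bilinear] bilinear_rsub[OF metric_bilinear]
    bilinear_lmul[OF metric_bilinear] bilinear_rmul[OF metric_bilinear]
  have vv: "g p v v > 0" using metric_pos[OF False] .
  \<comment> \<open>\<open>r *\<^sub>R v\<close> is the orthogonal projection of \<open>u\<close> onto the line through \<open>v\<close>.\<close>
  define r where "r = g p u v / g p v v"
  have "0 \<le> g p (u - r *\<^sub>R v) (u - r *\<^sub>R v)"
    using gnorm_power2[of p "u - r *\<^sub>R v"] by (metis zero_le_power2)
  also have "\<dots> = g p u u - 2 * r * g p u v + r * (r * g p v v)"
    by (simp add: b metric_sym[of p v u] algebra_simps)
  also have "r * g p v v = g p u v" using vv by (simp add: r_def)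
  finally have "r * g p u v \<le> g p u u" by simp
  then have "(g p u v)\<^sup>2 \<le> g p u u * g p v v"
    using vv by (simp add: r_def power2_eq_square field_simps)
  also have "\<dots> = (gnorm g p u * gnorm g p v)\<^sup>2"
    by (simp add: power_mult_distrib gnorm_power2)
  finally show ?thesis
    by (rule power2_le_imp_le) (simp add: gnorm_nonneg)
qed

lemma differential_has_derivative:
  assumes "differentiable_fun A f"
  shows "(f \<circ> chart_inv (chart_at A p) has_derivative differential A f p)
    (at (snd (chart_at A p) p))"
proof -
  have "(f \<circ> chart_inv (chart_at A p)) differentiable at (snd (chart_at A p) p)"
    using assms chart_at_mem unfolding differentiable_fun_def by blast
  then show ?thesis by (simp add: frechet_derivative_works differential_def[abs_def])
qed

lemma metric_riem_grad:
  assumes "differentiable_fun A f"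
  shows "g p (riem_grad A g f p) u = differential A f p u"
proof -
  have "\<exists>!w. \<forall>u. g p w u = differential A f p u"
    by (rule form_representation[OF metric_bilinear metric_pos
          has_derivative_linear[OF differential_has_derivative[OF assms]]])
  from theI'[OF this] show ?thesis by (simp add: riem_grad_def)
qed

lemma curve_has_derivative:
  assumes f: "differentiable_fun A f" and \<gamma>: "C1_curve A UNIV \<gamma>"
  shows "((\<lambda>s. f (\<gamma> s)) has_real_derivative
    g (\<gamma> t) (riem_grad A g f (\<gamma> t)) (velocity A UNIV \<gamma> t)) (at t)"
proof -
  have cont: "continuous_on UNIV \<gamma>" using \<gamma> by (simp add: C1_curve_def)
  define c where "c = chart_at A (\<gamma> t)"
  have c: "c \<in> A" "\<gamma> t \<in> fst c" by (simp_all add: c_def chart_at_mem)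
  have "(f \<circ> chart_inv c has_derivative differential A f (\<gamma> t))
      (at ((snd c \<circ> \<gamma>) t) within range (snd c \<circ> \<gamma>))"
    using differential_has_derivative[OF f, of "\<gamma> t"]
    by (simp add: c_def has_derivative_at_withinI)
  from vector_derivative_diff_chain_within[OF has_chart_velocity[OF \<gamma> c] this]
  have "((f \<circ> chart_inv c) \<circ> (snd c \<circ> \<gamma>) has_vector_derivative
      g (\<gamma> t) (riem_grad A g f (\<gamma> t)) (velocity A UNIV \<gamma> t)) (at t)"
    by (simp only: metric_riem_grad[OF f] velocity_def c_def)
  then have "((\<lambda>s. f (\<gamma> s)) has_vector_derivative
      g (\<gamma> t) (riem_grad A g f (\<gamma> t)) (velocity A UNIV \<gamma> t)) (at t)"
    by (rule has_vector_derivative_transform_within_open[where S = "\<gamma> -` fst c"])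
      (use c in \<open>auto simp: chart_inv_snd intro!: open_vimage open_chart[OF c(1)] cont\<close>)
  then show ?thesis by (simp add: has_real_derivative_iff_has_vector_derivative)
qed

lemma geodesic_speed:
  assumes \<gamma>: "geodesic A g UNIV \<gamma>" and t: "t \<ge> 0"
  shows "g (\<gamma> t) (velocity A UNIV \<gamma> t) (velocity A UNIV \<gamma> t)
    = g (\<gamma> 0) (velocity A UNIV \<gamma> 0) (velocity A UNIV \<gamma> 0)"
proof (cases "t = 0")
  case False
  then have t: "0 < t" using t by simp
  have C1: "C1_curve A UNIV \<gamma>" using \<gamma> by (simp add: geodesic_def)
  have "parallel_along A g {0..t} \<gamma> (velocity A {0..t} \<gamma>)"
    using geodesic_Icc[OF \<gamma> t] by (simp add: geodesic_def)
  from parallel_isometry[OF C1 t this this, of t] t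
  show ?thesis by (simp add: velocity_Icc[OF C1 t])
qed simp

lemma riem_dist_le_length:
  assumes "partition_points n \<tau>" and "\<And>i. i < n \<Longrightarrow> C1_curve A {\<tau> i..\<tau> (Suc i)} \<gamma>"
  shows "riem_dist A g (\<gamma> (\<tau> 0)) (\<gamma> (\<tau> n)) \<le> piecewise_C1_length A g n \<tau> \<gamma>"
  unfolding riem_dist_def
proof (rule cInf_lower)
  have "integral I (\<lambda>t. gnorm g (\<gamma> t) (velocity A I \<gamma> t)) \<ge> 0" for I :: "real set" and \<gamma>
  proof (cases "(\<lambda>t. gnorm g (\<gamma> t) (velocity A I \<gamma> t)) integrable_on I")
    case True
    then show ?thesis by (rule integral_nonneg) (simp add: gnorm_nonneg)
  qed (simp add: not_integrable_integral)
  then have "piecewise_C1_length A g n \<tau> \<gamma> \<ge> 0" for n \<tau> \<gamma>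
    unfolding piecewise_C1_length_def by (intro sum_nonneg)
  then show "bdd_below {piecewise_C1_length A g n' \<tau>' \<gamma>' | n' \<tau>' \<gamma>'. partition_points n' \<tau>' \<and>
      (\<forall>i<n'. C1_curve A {\<tau>' i..\<tau>' (Suc i)} \<gamma>') \<and> \<gamma>' (\<tau>' 0) = \<gamma> (\<tau> 0) \<and> \<gamma>' (\<tau>' n') = \<gamma> (\<tau> n)}"
    by (intro bdd_belowI[of _ 0]) auto
qed (use assms in blast)

lemma geodesic_dist_le:
  assumes \<gamma>: "geodesic A g UNIV \<gamma>" and t: "t > 0"
  shows "riem_dist A g (\<gamma> 0) (\<gamma> t) \<le> t * gnorm g (\<gamma> 0) (velocity A UNIV \<gamma> 0)"
proof -
  have C1: "C1_curve A UNIV \<gamma>" using \<gamma> by (simp add: geodesic_def)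
  define \<tau> :: "nat \<Rightarrow> real" where "\<tau> i = (if i = 0 then 0 else t)" for i
  have "riem_dist A g (\<gamma> (\<tau> 0)) (\<gamma> (\<tau> 1)) \<le> piecewise_C1_length A g 1 \<tau> \<gamma>"
    using t by (intro riem_dist_le_length)
      (auto simp: partition_points_def \<tau>_def C1_curve_Icc[OF C1])
  also have "\<dots> = integral {0..t} (\<lambda>s. gnorm g (\<gamma> s) (velocity A {0..t} \<gamma> s))"
    by (simp add: piecewise_C1_length_def \<tau>_def)
  also have "\<dots> = integral {0..t} (\<lambda>s. gnorm g (\<gamma> 0) (velocity A UNIV \<gamma> 0))"
  proof (rule integral_cong)
    fix s assume s: "s \<in> {0..t}"
    then show "gnorm g (\<gamma> s) (velocity A {0..t} \<gamma> s) = gnorm g (\<gamma> 0) (velocity A UNIV \<gamma> 0)"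
      using geodesic_speed[OF \<gamma>, of s] by (simp add: velocity_Icc[OF C1 t s] gnorm_def)
  qed
  also have "\<dots> = t * gnorm g (\<gamma> 0) (velocity A UNIV \<gamma> 0)" using t by simp
  finally show ?thesis by (simp add: \<tau>_def)
qed

text \<open>The descent inequality along a geodesic. The derivative of \<open>f \<circ> \<gamma>\<close> at \<open>t\<close> is the inner product of the
gradient with the velocity; replacing the gradient by the parallel transport of the initial gradient
gives the constant \<open>g p (riem_grad A g f p) v\<close>, since parallel transport is an isometry and the velocity
is parallel, and costs at most \<open>L * t * g p v v\<close> by the Lipschitz condition.\<close>

lemma geodesic_descent:
  assumes f: "differentiable_fun A f" and L: "L \<ge> 0" "lipschitz_grad A g f L"
    and \<gamma>: "geodesic A g UNIV \<gamma>"
  defines "p \<equiv> \<gamma> 0" and "v \<equiv> velocity A UNIV \<gamma> 0"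
  shows "f (\<gamma> 1) \<le> f p + g p (riem_grad A g f p) v + L / 2 * g p v v"
proof -
  have C1: "C1_curve A UNIV \<gamma>" using \<gamma> by (simp add: geodesic_def)
  define D where "D t = g (\<gamma> t) (riem_grad A g f (\<gamma> t)) (velocity A UNIV \<gamma> t)" for t
  have D: "D t - g p (riem_grad A g f p) v \<le> L * t * g p v v" if t: "0 < t" for t
  proof -
    obtain X where X: "parallel_along A g {0..t} \<gamma> X" and X0: "X 0 = riem_grad A g f p"
      using parallel_exists[OF C1 t] by blast
    define W where "W = velocity A UNIV \<gamma> t"
    have geo: "geodesic A g {0..t} \<gamma>" by (rule geodesic_Icc[OF \<gamma> t])
    then have V: "parallel_along A g {0..t} \<gamma> (velocity A {0..t} \<gamma>)" by (simp add: geodesic_def)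
    have XV: "g (\<gamma> t) (X t) W = g p (riem_grad A g f p) v"
      using parallel_isometry[OF C1 t X V, of t] t
      by (simp add: velocity_Icc[OF C1 t] X0 p_def v_def W_def)
    have W: "gnorm g (\<gamma> t) W = gnorm g p v"
      using geodesic_speed[OF \<gamma>, of t] t by (simp add: gnorm_def W_def p_def v_def)
    have "gnorm g (\<gamma> t) (riem_grad A g f (\<gamma> t) - X t)
        = gnorm g (\<gamma> t) (parallel_transport A g 0 t \<gamma> (riem_grad A g f p) - riem_grad A g f (\<gamma> t))"
      using parallel_transport_eq[OF C1 t X]
      by (simp add: X0 gnorm_def bilinear_lsub[OF metric_bilinear] bilinear_rsub[OF metric_bilinear])
    also have "\<dots> \<le> L * riem_dist A g p (\<gamma> t)"
      using L(2) t geo unfolding lipschitz_grad_def p_def by blast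
    also have "\<dots> \<le> L * (t * gnorm g p v)"
      using geodesic_dist_le[OF \<gamma> t] L(1) by (intro mult_left_mono) (simp_all add: p_def v_def)
    finally have Lip: "gnorm g (\<gamma> t) (riem_grad A g f (\<gamma> t) - X t) \<le> L * (t * gnorm g p v)" .
    have "D t - g p (riem_grad A g f p) v = g (\<gamma> t) (riem_grad A g f (\<gamma> t) - X t) W"
      by (simp add: D_def W_def[symmetric] XV bilinear_lsub[OF metric_bilinear])
    also have "\<dots> \<le> gnorm g (\<gamma> t) (riem_grad A g f (\<gamma> t) - X t) * gnorm g (\<gamma> t) W"
      by (rule gnorm_Cauchy_Schwarz)
    also have "\<dots> \<le> L * (t * gnorm g p v) * gnorm g p v"
      unfolding W by (rule mult_right_mono[OF Lip gnorm_nonneg])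
    also have "\<dots> = L * t * g p v v"
      by (simp add: gnorm_power2[symmetric] power2_eq_square)
    finally show ?thesis .
  qed
  \<comment> \<open>The claim is that \<open>\<phi> 1 \<le> \<phi> 0\<close>.\<close>
  define \<phi> where "\<phi> t = f (\<gamma> t) - t * g p (riem_grad A g f p) v - L / 2 * t\<^sup>2 * g p v v" for t
  have "\<phi> 1 \<le> \<phi> 0"
  proof (rule DERIV_nonpos_imp_nonincreasing[of 0 1 \<phi>])
    fix t :: real assume t: "0 \<le> t" "t \<le> 1"
    have "(\<phi> has_real_derivative D t - g p (riem_grad A g f p) v - L * t * g p v v) (at t)"
      unfolding \<phi>_def D_def
      by (auto intro!: derivative_eq_intros curve_has_derivative[OF f C1])
    moreover have "D t - g p (riem_grad A g f p) v - L * t * g p v v \<le> 0"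
      using D[of t] t by (cases "t = 0") (simp_all add: D_def p_def v_def)
    ultimately show "\<exists>y. (\<phi> has_real_derivative y) (at t) \<and> y \<le> 0" by blast
  qed simp
  then show ?thesis by (simp add: \<phi>_def p_def)
qed

end

lemma (in complete_riemannian_manifold) descent:
  assumes "differentiable_fun A f" and "L \<ge> 0" "lipschitz_grad A g f L"
  shows "f (riem_exp A g p v) \<le> f p + g p (riem_grad A g f p) v + L / 2 * g p v v"
proof -
  define \<gamma> where "\<gamma> = (SOME \<gamma>. geodesic A g UNIV \<gamma> \<and> \<gamma> 0 = p \<and> velocity A UNIV \<gamma> 0 = v)"
  have \<gamma>: "geodesic A g UNIV \<gamma>" "\<gamma> 0 = p" "velocity A UNIV \<gamma> 0 = v"
    using someI_ex[OF complete[of p v]] by (simp_all add: \<gamma>_def)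
  from geodesic_descent[OF assms \<gamma>(1)] show ?thesis
    by (simp add: \<gamma>(2,3)) (simp add: \<gamma>_def riem_exp_def)
qed

lemma (in complete_riemannian_manifold) gradient_step:
  assumes "differentiable_fun A f" and "L \<ge> 0" "lipschitz_grad A g f L"
  shows "f (riem_exp A g p (- r *\<^sub>R riem_grad A g f p))
    \<le> f p - r * (1 - L * r / 2) * (gnorm g p (riem_grad A g f p))\<^sup>2"
proof -
  have "r * (r * x) * (L / 2) = r * x - r * (1 - L * r / 2) * x" for x :: real
    by (simp add: algebra_simps)
  with descent[OF assms, of p "- r *\<^sub>R riem_grad A g f p"] show ?thesis
    unfolding gnorm_power2
    by (simp add: bilinear_lmul[OF metric_bilinear] bilinear_rmul[OF metric_bilinear]
        bilinear_lneg[OF metric_bilinear] bilinear_rneg[OF metric_bilinear] algebra_simps)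
qed

lemma (in complete_riemannian_manifold) gradient_le_gap:
  assumes f: "differentiable_fun A f" and L: "L \<ge> 0" "lipschitz_grad A g f L"
    and min: "\<And>y. fstar \<le> f y" and grad: "riem_grad A g f p \<noteq> 0"
  shows "L > 0" and "(gnorm g p (riem_grad A g f p))\<^sup>2 \<le> 2 * L * (f p - fstar)"
proof -
  define G where "G = (gnorm g p (riem_grad A g f p))\<^sup>2"
  have G: "G > 0" unfolding G_def by (rule zero_less_power[OF gnorm_pos[OF grad]])
  have step: "t * (1 - L * t / 2) * G \<le> f p - fstar" for t
    using gradient_step[OF f L, of p t] min[of "riem_exp A g p (- t *\<^sub>R riem_grad A g f p)"]
    by (simp add: G_def)
  show "L > 0"
  proof (rule ccontr)
    assume "\<not> L > 0"
    then have "L = 0" using L by simp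
    \<comment> \<open>With \<open>L = 0\<close>, gradient steps would decrease \<open>f\<close> in proportion to their length, without bound.\<close>
    with step[of "(f p - fstar + 1) / G"] G show False by simp
  qed
  with step[of "1 / L"] show "(gnorm g p (riem_grad A g f p))\<^sup>2 \<le> 2 * L * (f p - fstar)"
    by (simp add: G_def field_simps)
qed

section \<open>The adaptive step sizes\<close>

lemma geometric_decay_le:
  fixes r C \<epsilon> :: real
  assumes r: "0 < r" "r < 1" and \<epsilon>: "0 < \<epsilon>" "\<epsilon> < C" and n: "ln (C * inverse \<epsilon>) / \<bar>ln r\<bar> \<le> real n"
  shows "r ^ n * C \<le> \<epsilon>"
proof -
  have "ln r < 0" using r by simp
  then have "ln (C * inverse \<epsilon>) \<le> - (real n * ln r)" using n by (simp add: field_simps)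
  then have "ln (r ^ n * C) \<le> ln \<epsilon>"
    using r \<epsilon> by (simp add: ln_mult ln_inverse ln_realpow)
  then show ?thesis using r \<epsilon> by (subst (asm) ln_le_cancel_iff) auto
qed

text \<open>The real sequences behind the algorithm: \<open>s k\<close> is the gap between the value of the function at the \<open>k\<close>-th
iterate and its minimum, \<open>G k\<close> the norm of the gradient there, and \<open>step\<close> the descent inequality for the
step size \<open>\<eta> / sqrt (\<beta> (Suc k))\<close>. The bound \<open>smoothness_bound\<close> follows from the descent inequality for
step size \<open>1 / L\<close> at the starting point.\<close>

locale adagrad_recursion =
  fixes s G \<beta> :: "nat \<Rightarrow> real" and L \<mu> \<eta> :: real
  assumes L: "L > 0" and \<mu>: "\<mu> > 0" and \<eta>: "\<eta> > 0"
    and \<beta>_0: "\<beta> 0 = 0" and \<beta>_Suc: "\<And>k. \<beta> (Suc k) = \<beta> k + (G k)\<^sup>2"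
    and s_nonneg: "\<And>k. s k \<ge> 0" and G_0: "G 0 > 0"
    and step: "\<And>k. s (Suc k) \<le> s k
      - \<eta> / sqrt (\<beta> (Suc k)) * (1 - L * (\<eta> / sqrt (\<beta> (Suc k))) / 2) * (G k)\<^sup>2"
    and error_bound: "\<And>k. \<mu> * s k \<le> (G k)\<^sup>2"
    and smoothness_bound: "(G 0)\<^sup>2 \<le> 2 * L * s 0"
begin

text \<open>\<open>C\<close> bounds the gap at the end of the first phase, \<open>\<alpha>\<^sub>m\<close> bounds the step sizes of the second phase from
below, and \<open>r\<close> is the resulting contraction factor. The number \<open>\<alpha>\<^sub>m\<close> is the \<open>\<alpha>min\<close> of the theorem, since
\<open>2 * C / \<eta>\<^sup>2 = 2 * s 0 / \<eta>\<^sup>2 + \<eta>\<^sup>2 * L ^ 3 / (G 0)\<^sup>2\<close>.\<close>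

definition C :: real where "C = s 0 + \<eta> ^ 4 * L ^ 3 / (2 * (G 0)\<^sup>2)"

definition \<alpha>\<^sub>m :: real where "\<alpha>\<^sub>m = inverse (L + 2 * C / \<eta>\<^sup>2)"

definition r :: real where "r = 1 - \<mu> * \<alpha>\<^sub>m / 2"

lemma s_0_pos: "s 0 > 0"
proof -
  have "0 < 2 * L * s 0" using smoothness_bound G_0 zero_less_power[of "G 0" 2] by linarith
  then show ?thesis using L by (simp add: zero_less_mult_iff)
qed

lemma \<mu>_le: "\<mu> \<le> 2 * L"
proof -
  have "\<mu> * s 0 \<le> 2 * L * s 0" using error_bound[of 0] smoothness_bound by linarith
  then show ?thesis using s_0_pos by simp
qed

lemma C_ge: "s 0 \<le> C" and C_pos: "C > 0"
  using s_0_pos L \<eta> G_0 by (auto simp: C_def add_pos_nonneg)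

lemma \<alpha>\<^sub>m_pos: "\<alpha>\<^sub>m > 0" and \<alpha>\<^sub>m_L: "\<alpha>\<^sub>m * L < 1" and \<alpha>\<^sub>m_C: "\<alpha>\<^sub>m * C < \<eta>\<^sup>2 / 2"
proof -
  have D: "L + 2 * C / \<eta>\<^sup>2 > 0" using L C_pos \<eta> by (simp add: add_pos_pos)
  then show "\<alpha>\<^sub>m > 0" by (simp add: \<alpha>\<^sub>m_def)
  then have pos: "\<alpha>\<^sub>m * L > 0" "\<alpha>\<^sub>m * (2 * C / \<eta>\<^sup>2) > 0" using L C_pos \<eta> by simp_all
  have "\<alpha>\<^sub>m * L + \<alpha>\<^sub>m * (2 * C / \<eta>\<^sup>2) = 1"
    using D unfolding \<alpha>\<^sub>m_def distrib_left[symmetric] by simp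
  then have "\<alpha>\<^sub>m * L < 1" and "\<alpha>\<^sub>m * (2 * C / \<eta>\<^sup>2) < 1" using pos by linarith+
  then show "\<alpha>\<^sub>m * L < 1" and "\<alpha>\<^sub>m * C < \<eta>\<^sup>2 / 2"
    using \<eta> by (simp_all add: field_simps)
qed

lemma r_pos: "0 < r" and r_less_1: "r < 1"
proof -
  have "\<mu> * \<alpha>\<^sub>m \<le> 2 * L * \<alpha>\<^sub>m" using \<mu>_le \<alpha>\<^sub>m_pos by (intro mult_right_mono) auto
  then show "0 < r" using \<alpha>\<^sub>m_L by (simp add: r_def mult.commute)
  show "r < 1" using \<mu> \<alpha>\<^sub>m_pos by (simp add: r_def)
qed

text \<open>One contraction step lowers \<open>C\<close> by less than \<open>L * \<eta>\<^sup>2 / 2\<close>; this is used to absorb one iteration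
when the two phases are put together.\<close>

lemma r_C: "C - L * \<eta>\<^sup>2 / 2 < r * C"
proof -
  have "\<mu> * (\<alpha>\<^sub>m * C) \<le> 2 * L * (\<alpha>\<^sub>m * C)"
    using \<mu>_le \<alpha>\<^sub>m_pos C_pos by (intro mult_right_mono) auto
  also have "\<dots> < 2 * L * (\<eta>\<^sup>2 / 2)"
    using \<alpha>\<^sub>m_C L by (intro mult_strict_left_mono) auto
  finally show ?thesis by (simp add: r_def algebra_simps)
qed

lemma \<beta>_mono: "k \<le> l \<Longrightarrow> \<beta> k \<le> \<beta> l"
  by (rule lift_Suc_mono_le[of \<beta>]) (simp_all add: \<beta>_Suc)

lemma \<beta>_1: "\<beta> (Suc 0) = (G 0)\<^sup>2"
  by (simp add: \<beta>_Suc \<beta>_0)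

lemma \<beta>_ge: "(G 0)\<^sup>2 \<le> \<beta> (Suc k)"
  using \<beta>_mono[of "Suc 0" "Suc k"] by (simp add: \<beta>_1)

lemma \<beta>_pos: "\<beta> (Suc k) > 0"
  using \<beta>_ge[of k] G_0 zero_less_power[of "G 0" 2] by linarith

lemma \<beta>_nonneg: "\<beta> k \<ge> 0"
  using \<beta>_mono[of 0 k] by (simp add: \<beta>_0)

text \<open>Once \<open>sqrt (\<beta> (Suc k))\<close> has reached \<open>\<eta> * L\<close>, the step size is at most \<open>1 / L\<close>. The gap then does
not increase, and the growth of \<open>sqrt \<beta>\<close> is paid for by the decrease of the gap.\<close>

lemma late_step:
  assumes "(\<eta> * L)\<^sup>2 \<le> \<beta> (Suc k)"
  shows "s (Suc k) \<le> s k - \<eta> / sqrt (\<beta> (Suc k)) * (G k)\<^sup>2 / 2"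
    and "s (Suc k) + \<eta> / 2 * sqrt (\<beta> (Suc k)) \<le> s k + \<eta> / 2 * sqrt (\<beta> k)"
proof -
  define b where "b = sqrt (\<beta> (Suc k))"
  have b: "b > 0" using \<beta>_pos by (simp add: b_def)
  have "\<eta> * L \<le> b"
    unfolding b_def using assms by (rule real_le_rsqrt)
  then have "1 / 2 \<le> 1 - L * (\<eta> / b) / 2" using b by (simp add: field_simps)
  then have "\<eta> / b * (G k)\<^sup>2 * (1 / 2) \<le> \<eta> / b * (G k)\<^sup>2 * (1 - L * (\<eta> / b) / 2)"
    using b \<eta> by (intro mult_left_mono) auto
  also have "\<dots> = \<eta> / b * (1 - L * (\<eta> / b) / 2) * (G k)\<^sup>2" by (simp only: mult_ac)
  finally show 1: "s (Suc k) \<le> s k - \<eta> / sqrt (\<beta> (Suc k)) * (G k)\<^sup>2 / 2"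
    using step[of k] unfolding b_def by linarith
  define a where "a = sqrt (\<beta> k)"
  have a: "a \<ge> 0" using \<beta>_nonneg by (simp add: a_def)
  have ab: "a \<le> b" using \<beta>_mono[of k "Suc k"] by (simp add: a_def b_def)
  have "(G k)\<^sup>2 = b\<^sup>2 - a\<^sup>2"
    using \<beta>_nonneg[of k] \<beta>_nonneg[of "Suc k"] \<beta>_Suc[of k] by (simp add: a_def b_def)
  also have "\<dots> \<ge> (b - a) * b"
    using mult_nonneg_nonneg[OF a, of "b - a"] ab by (simp add: power2_eq_square algebra_simps)
  finally have "\<eta> / b * ((b - a) * b) \<le> \<eta> / b * (G k)\<^sup>2"
    using \<eta> b by (intro mult_left_mono) auto
  then have "\<eta> * (b - a) \<le> \<eta> / b * (G k)\<^sup>2" using b by simp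
  then show "s (Suc k) + \<eta> / 2 * sqrt (\<beta> (Suc k)) \<le> s k + \<eta> / 2 * sqrt (\<beta> k)"
    using 1 by (simp add: a_def b_def algebra_simps)
qed

text \<open>Linear convergence in the second phase, which starts at \<open>K\<close>: the potential \<open>s k + \<eta> / 2 * sqrt (\<beta> k)\<close> is
nonincreasing there, which bounds \<open>\<beta>\<close> from above and thus the step sizes from below.\<close>

lemma late_decay:
  assumes K: "\<beta> K \<le> (\<eta> * L)\<^sup>2" "(\<eta> * L)\<^sup>2 \<le> \<beta> (Suc K)" and sK: "s K \<le> C"
  shows "s (K + j) \<le> r ^ j * s K"
proof (induction j)
  case (Suc j)
  have late: "(\<eta> * L)\<^sup>2 \<le> \<beta> (Suc (K + i))" for i
    using K(2) \<beta>_mono[of "Suc K" "Suc (K + i)"] by simp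
  have pot: "s (K + i) + \<eta> / 2 * sqrt (\<beta> (K + i)) \<le> s K + \<eta> / 2 * sqrt (\<beta> K)" for i
  proof (induction i)
    case (Suc i)
    then show ?case using late_step(2)[OF late[of i]] by simp
  qed simp
  define b where "b = sqrt (\<beta> (Suc (K + j)))"
  have b: "b > 0" using \<beta>_pos by (simp add: b_def)
  have bK: "sqrt (\<beta> K) \<le> \<eta> * L"
    using K(1) L \<eta> by (intro real_le_lsqrt) auto
  have "\<eta> / 2 * b \<le> C + \<eta> / 2 * (\<eta> * L)"
  proof -
    have "\<eta> / 2 * sqrt (\<beta> K) \<le> \<eta> / 2 * (\<eta> * L)"
      using bK \<eta> by (intro mult_left_mono) auto
    then show ?thesis
      using pot[of "Suc j"] sK s_nonneg[of "K + Suc j"] unfolding b_def add_Suc_right by linarith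
  qed
  then have "2 * (\<eta> / 2 * b) \<le> 2 * (C + \<eta> / 2 * (\<eta> * L))"
    by (rule mult_left_mono) simp
  also have "\<dots> = \<eta> * (\<eta> * (L + 2 * C / \<eta>\<^sup>2))"
    using \<eta> by (simp add: field_simps power2_eq_square)
  finally have "\<eta> * b \<le> \<eta> * (\<eta> * (L + 2 * C / \<eta>\<^sup>2))" by simp
  then have "b \<le> \<eta> * (L + 2 * C / \<eta>\<^sup>2)" using \<eta> by simp
  then have "\<alpha>\<^sub>m * b \<le> \<alpha>\<^sub>m * (\<eta> * (L + 2 * C / \<eta>\<^sup>2))"
    using \<alpha>\<^sub>m_pos by (intro mult_left_mono) auto
  also have "\<dots> = \<eta>"
    using \<alpha>\<^sub>m_pos by (simp add: \<alpha>\<^sub>m_def)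
  finally have "\<alpha>\<^sub>m \<le> \<eta> / b" using b by (simp add: field_simps)
  then have "\<alpha>\<^sub>m * (\<mu> * s (K + j)) \<le> \<eta> / b * (G (K + j))\<^sup>2"
    using error_bound[of "K + j"] \<alpha>\<^sub>m_pos \<mu> s_nonneg \<eta> b by (intro mult_mono) auto
  then have "s (K + Suc j) \<le> r * s (K + j)"
    using late_step(1)[OF late[of j]] by (simp add: b_def r_def algebra_simps)
  also have "\<dots> \<le> r * (r ^ j * s K)"
    using Suc r_pos by (intro mult_left_mono) auto
  finally show ?case by simp
qed simp

text \<open>In the first phase the gap may increase. For the step with index \<open>0\<close>, the descent inequality bounds the
change by \<open>L * \<eta>\<^sup>2 / 2 - \<eta> * G 0\<close>; from each later step only the possible increase
by \<open>L * \<eta>\<^sup>2 / 2 * (G k)\<^sup>2 / \<beta> (Suc k)\<close> is kept, and these sum up to a logarithm.\<close>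

lemma early_growth:
  "s (Suc k) \<le> s 0 - \<eta> * G 0 + L * \<eta>\<^sup>2 / 2 * (1 + ln (\<beta> (Suc k) / (G 0)\<^sup>2))"
proof (induction k)
  case 0
  have "\<eta> / G 0 * (1 - L * (\<eta> / G 0) / 2) * (G 0)\<^sup>2 = \<eta> * G 0 - L * \<eta>\<^sup>2 / 2"
    using G_0 by (simp add: field_simps power2_eq_square)
  then show ?case using step[of 0] G_0 by (simp add: \<beta>_1)
next
  case (Suc k)
  define b where "b = \<beta> (Suc k)"
  define b' where "b' = \<beta> (Suc (Suc k))"
  have b: "b > 0" "b' > 0" using \<beta>_pos by (simp_all add: b_def b'_def)
  have G: "(G (Suc k))\<^sup>2 = b' - b" using \<beta>_Suc[of "Suc k"] by (simp add: b_def b'_def)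
  have "\<eta> / sqrt b' * (1 - L * (\<eta> / sqrt b') / 2) * (G (Suc k))\<^sup>2
      = \<eta> / sqrt b' * (G (Suc k))\<^sup>2 - L * \<eta>\<^sup>2 / 2 * ((b' - b) / b')"
    using b by (simp add: G[symmetric] right_diff_distrib left_diff_distrib power2_eq_square[of \<eta>])
      (simp add: field_simps)
  moreover have "\<eta> / sqrt b' * (G (Suc k))\<^sup>2 \<ge> 0" using \<eta> b by simp
  ultimately have "s (Suc (Suc k)) \<le> s (Suc k) + L * \<eta>\<^sup>2 / 2 * ((b' - b) / b')"
    using step[of "Suc k"] by (simp add: b'_def)
  also have "(b' - b) / b' \<le> ln (b' / b)"
    using ln_le_minus_one[of "b / b'"] b by (simp add: ln_div field_simps)
  then have "L * \<eta>\<^sup>2 / 2 * ((b' - b) / b') \<le> L * \<eta>\<^sup>2 / 2 * ln (b' / b)"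
    using L \<eta> by (intro mult_left_mono) auto
  also have "s (Suc k) \<le> s 0 - \<eta> * G 0 + L * \<eta>\<^sup>2 / 2 * (1 + ln (b / (G 0)\<^sup>2))"
    using Suc by (simp add: b_def)
  also have "s 0 - \<eta> * G 0 + L * \<eta>\<^sup>2 / 2 * (1 + ln (b / (G 0)\<^sup>2)) + L * \<eta>\<^sup>2 / 2 * ln (b' / b)
      = s 0 - \<eta> * G 0 + L * \<eta>\<^sup>2 / 2 * (1 + ln (b' / (G 0)\<^sup>2))"
  proof -
    have "ln (b' / (G 0)\<^sup>2) = ln (b / (G 0)\<^sup>2) + ln (b' / b)"
      using b G_0 by (simp add: ln_div)
    then show ?thesis by (simp only: distrib_left add.assoc)
  qed
  finally show ?case by (simp add: b'_def)
qed

text \<open>At the end of the first phase the gap is below \<open>C\<close> by more than one contraction step. With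
\<open>z = \<eta> * L / G 0\<close> this amounts to \<open>2 * z \<le> z\<^sup>2 + 2 / z\<close>.\<close>

lemma early_bound:
  assumes K: "\<beta> (Suc k) < (\<eta> * L)\<^sup>2" and large: "G 0 < \<eta> * L"
  shows "s (Suc k) < r * C"
proof -
  define z where "z = \<eta> * L / G 0"
  have z: "z > 1" using large G_0 by (simp add: z_def field_simps)
  have "\<beta> (Suc k) / (G 0)\<^sup>2 < z\<^sup>2"
    using K G_0 by (simp add: z_def power_divide divide_strict_right_mono)
  then have "ln (\<beta> (Suc k) / (G 0)\<^sup>2) < ln (z\<^sup>2)"
    using \<beta>_pos[of k] G_0 z by (subst ln_less_cancel_iff) auto
  also have "\<dots> = 2 * ln z" using z by (simp add: ln_realpow)
  also have "\<dots> \<le> 2 * (z - 1)" using ln_le_minus_one[of z] z by simp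
  finally have ln: "1 + ln (\<beta> (Suc k) / (G 0)\<^sup>2) \<le> 2 * z - 1" by simp
  \<comment> \<open>The cubic \<open>z ^ 3 - 2 * z\<^sup>2 + 2\<close> has its minimum \<open>22 / 27\<close> over \<open>z \<ge> 0\<close> at \<open>z = 4 / 3\<close>.\<close>
  have "0 \<le> (z - 4 / 3)\<^sup>2 * (z + 2 / 3) + 22 / 27" using z by simp
  also have "\<dots> = z ^ 3 - 2 * z\<^sup>2 + 2"
    by (simp add: power2_eq_square power3_eq_cube field_simps)
  finally have "2 * z - 1 \<le> z\<^sup>2 - 1 + 2 / z"
    using z by (simp add: field_simps power2_eq_square power3_eq_cube)
  with ln have "L * \<eta>\<^sup>2 / 2 * (1 + ln (\<beta> (Suc k) / (G 0)\<^sup>2)) \<le> L * \<eta>\<^sup>2 / 2 * (z\<^sup>2 - 1 + 2 / z)"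
    using L \<eta> by (intro mult_left_mono) auto
  also have "\<dots> = \<eta> ^ 4 * L ^ 3 / (2 * (G 0)\<^sup>2) - L * \<eta>\<^sup>2 / 2 + \<eta> * G 0"
  proof -
    have "L * \<eta>\<^sup>2 / 2 * z\<^sup>2 = \<eta> ^ 4 * L ^ 3 / (2 * (G 0)\<^sup>2)"
      by (simp add: z_def power_divide power_mult_distrib power2_eq_square power3_eq_cube
          power4_eq_xxxx)
    moreover have "L * \<eta>\<^sup>2 / 2 * (2 / z) = \<eta> * G 0"
      using L \<eta> G_0 by (simp add: z_def field_simps power2_eq_square)
    ultimately show ?thesis by (simp add: distrib_left right_diff_distrib)
  qed
  finally have "s (Suc k) \<le> C - L * \<eta>\<^sup>2 / 2"
    using early_growth[of k] by (simp add: C_def)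
  then show ?thesis using r_C by linarith
qed

text \<open>The number of contraction steps that take \<open>C\<close> to \<open>\<epsilon>\<close>, as a real number, if \<open>\<epsilon> < C\<close>.\<close>

definition Y :: "real \<Rightarrow> real" where "Y \<epsilon> = \<bar>ln (C * inverse \<epsilon>)\<bar> / \<bar>ln r\<bar>"

lemma Y_nonneg: "Y \<epsilon> \<ge> 0"
  by (simp add: Y_def)

lemma Y_eq: "0 < \<epsilon> \<Longrightarrow> \<epsilon> < C \<Longrightarrow> Y \<epsilon> = ln (C * inverse \<epsilon>) / \<bar>ln r\<bar>"
  by (simp add: Y_def field_simps)

lemma Y_pos: "0 < \<epsilon> \<Longrightarrow> \<epsilon> < C \<Longrightarrow> Y \<epsilon> > 0"
  using r_pos r_less_1 by (simp add: Y_def field_simps)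

lemma hitting_time_large_gradient:
  assumes "\<epsilon> > 0" and large: "\<eta> * L \<le> G 0"
  shows "\<exists>m. s m \<le> \<epsilon> \<and> real m < 1 + Y \<epsilon>"
proof (cases "C \<le> \<epsilon>")
  case True
  then show ?thesis using C_ge Y_nonneg[of \<epsilon>] by (intro exI[of _ 0]) auto
next
  case False
  define n where "n = nat \<lceil>Y \<epsilon>\<rceil>"
  have n: "Y \<epsilon> \<le> real n" "real n < 1 + Y \<epsilon>"
    using Y_nonneg[of \<epsilon>] unfolding n_def by linarith+
  have "(\<eta> * L)\<^sup>2 \<le> \<beta> (Suc 0)"
    unfolding \<beta>_1 using large L \<eta> by (intro power_mono) auto
  then have "s (0 + n) \<le> r ^ n * s 0"
    by (intro late_decay) (simp_all add: \<beta>_0 C_ge)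
  also have "\<dots> \<le> r ^ n * C"
    using C_ge r_pos by (intro mult_left_mono) auto
  also have "\<dots> \<le> \<epsilon>"
    using n(1) False assms(1) by (intro geometric_decay_le r_pos r_less_1) (simp_all add: Y_eq)
  finally show ?thesis using n(2) by (intro exI[of _ n]) simp
qed

lemma \<beta>_linear_growth:
  assumes "\<And>i. i < m \<Longrightarrow> \<epsilon> < s i" and "m > 0"
  shows "(G 0)\<^sup>2 + (real m - 1) * (\<mu> * \<epsilon>) \<le> \<beta> m"
  using assms
proof (induction m)
  case (Suc m)
  show ?case
  proof (cases "m = 0")
    case False
    then have "(G 0)\<^sup>2 + (real m - 1) * (\<mu> * \<epsilon>) \<le> \<beta> m" using Suc by simp
    moreover have "\<mu> * \<epsilon> \<le> \<mu> * s m"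
      using Suc.prems(1)[of m] \<mu> by (intro mult_left_mono) auto
    ultimately show ?thesis using \<beta>_Suc[of m] error_bound[of m] by (simp add: algebra_simps)
  qed (simp add: \<beta>_1)
qed simp

text \<open>Before the gap reaches \<open>\<epsilon>\<close>, every iteration adds at least \<open>\<mu> * \<epsilon>\<close> to \<open>\<beta>\<close>, so the first phase cannot last
long. The comparison with the logarithm is \<open>1 - inverse y \<le> ln y\<close>.\<close>

lemma early_length:
  assumes \<epsilon>: "\<epsilon> > 0" and m: "\<And>i. i < m \<Longrightarrow> \<epsilon> < s i" "\<beta> m < (\<eta> * L)\<^sup>2"
    and small: "G 0 < \<eta> * L"
  shows "real m < 1 + (\<eta>\<^sup>2 * L\<^sup>2 / \<mu> * inverse \<epsilon> + 1) * ln (\<eta>\<^sup>2 * L\<^sup>2 / (G 0)\<^sup>2)"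
proof -
  define y where "y = \<eta>\<^sup>2 * L\<^sup>2 / (G 0)\<^sup>2"
  have "(G 0)\<^sup>2 < (\<eta> * L)\<^sup>2"
    using small G_0 by (intro power_strict_mono) auto
  then have y: "y > 1" using G_0 by (simp add: y_def power_mult_distrib)
  then have lny: "ln y > 0" by simp
  have "1 - inverse y \<le> ln y"
    using ln_le_minus_one[of "inverse y"] y by (simp add: ln_inverse)
  then have "\<eta>\<^sup>2 * L\<^sup>2 * (1 - inverse y) \<le> \<eta>\<^sup>2 * L\<^sup>2 * ln y"
    by (intro mult_left_mono) auto
  moreover have "\<eta>\<^sup>2 * L\<^sup>2 * inverse y = (G 0)\<^sup>2"
    using L \<eta> by (simp add: y_def)
  ultimately have *: "(\<eta> * L)\<^sup>2 - (G 0)\<^sup>2 \<le> \<eta>\<^sup>2 * L\<^sup>2 * ln y"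
    by (simp add: right_diff_distrib power_mult_distrib)
  have "(real m - 1) * (\<mu> * \<epsilon>) \<le> \<eta>\<^sup>2 * L\<^sup>2 * ln y"
  proof (cases "m = 0")
    case True
    have "0 \<le> \<mu> * \<epsilon> + \<eta>\<^sup>2 * L\<^sup>2 * ln y" using \<mu> \<epsilon> lny by (intro add_nonneg_nonneg) auto
    then show ?thesis using True by simp
  next
    case False
    then show ?thesis using \<beta>_linear_growth[of m \<epsilon>] m * by simp
  qed
  then have "real m - 1 \<le> \<eta>\<^sup>2 * L\<^sup>2 / \<mu> * inverse \<epsilon> * ln y"
    using \<mu> \<epsilon> by (simp add: field_simps)
  then show ?thesis using lny by (simp add: y_def[symmetric] distrib_right)
qed

text \<open>Either the gap reaches \<open>\<epsilon>\<close> in the first phase, or the first phase ends and the second one takes over.\<close>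

lemma hitting_time_small_gradient:
  assumes \<epsilon>: "\<epsilon> > 0" and small: "G 0 < \<eta> * L"
  shows "\<exists>m. s m \<le> \<epsilon> \<and>
    real m < 1 + (\<eta>\<^sup>2 * L\<^sup>2 / \<mu> * inverse \<epsilon> + 1) * ln (\<eta>\<^sup>2 * L\<^sup>2 / (G 0)\<^sup>2) + Y \<epsilon>"
proof (cases "\<exists>m. s m \<le> \<epsilon> \<and> \<beta> m < (\<eta> * L)\<^sup>2")
  case True
  then obtain m0 where m0: "s m0 \<le> \<epsilon>" "\<beta> m0 < (\<eta> * L)\<^sup>2" by blast
  define m where "m = (LEAST m. s m \<le> \<epsilon>)"
  have m: "s m \<le> \<epsilon>" "m \<le> m0"
    unfolding m_def using m0(1) by (rule LeastI, rule Least_le)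
  have below: "\<epsilon> < s i" if "i < m" for i
    using not_less_Least[of i "\<lambda>m. s m \<le> \<epsilon>"] that by (simp add: m_def not_le)
  have "\<beta> m < (\<eta> * L)\<^sup>2" using \<beta>_mono[OF m(2)] m0(2) by simp
  from early_length[OF \<epsilon> below this small] show ?thesis
    using m(1) Y_nonneg[of \<epsilon>] by (intro exI[of _ m]) simp
next
  case False
  then have early: "\<epsilon> < s k" if "\<beta> k < (\<eta> * L)\<^sup>2" for k using that by (meson not_le)
  have "\<exists>k. \<not> \<beta> k < (\<eta> * L)\<^sup>2"
  proof (rule ccontr)
    assume "\<nexists>k. \<not> \<beta> k < (\<eta> * L)\<^sup>2"
    then have "real m < 1 + (\<eta>\<^sup>2 * L\<^sup>2 / \<mu> * inverse \<epsilon> + 1) * ln (\<eta>\<^sup>2 * L\<^sup>2 / (G 0)\<^sup>2)" for m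
      using early by (intro early_length[OF \<epsilon> _ _ small]) auto
    then show False using reals_Archimedean2 less_asym by blast
  qed
  then obtain l where l: "\<not> \<beta> l < (\<eta> * L)\<^sup>2" "\<And>i. i < l \<Longrightarrow> \<beta> i < (\<eta> * L)\<^sup>2"
    using exists_least_iff[of "\<lambda>k. \<not> \<beta> k < (\<eta> * L)\<^sup>2"] by blast
  have sq: "(G 0)\<^sup>2 < (\<eta> * L)\<^sup>2"
    using small G_0 by (intro power_strict_mono) auto
  have "\<beta> 0 < (\<eta> * L)\<^sup>2" "\<beta> (Suc 0) < (\<eta> * L)\<^sup>2"
    using sq L \<eta> by (simp_all add: \<beta>_0 \<beta>_1)
  then have "l \<noteq> 0" "l \<noteq> Suc 0" using l(1) by metis+
  then obtain k where k: "l = Suc (Suc k)" by (metis not0_implies_Suc)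
  define K where "K = Suc k"
  have K: "\<beta> K < (\<eta> * L)\<^sup>2" "(\<eta> * L)\<^sup>2 \<le> \<beta> (Suc K)"
    using l by (simp_all add: k K_def not_less)
  have sK: "s K < r * C" unfolding K_def using K(1) small by (intro early_bound) (simp_all add: K_def)
  have rC: "r * C < C" using r_less_1 C_pos by simp
  have \<epsilon>C: "\<epsilon> < C" using early[OF K(1)] sK rC by linarith
  have Y: "Y \<epsilon> > 0" by (rule Y_pos[OF \<epsilon> \<epsilon>C])
  \<comment> \<open>One contraction step is already contained in \<open>sK\<close>, so that one step less than usual suffices.\<close>
  define n where "n = nat (\<lceil>Y \<epsilon>\<rceil> - 1)"
  have n: "Y \<epsilon> \<le> real (Suc n)" "real n < Y \<epsilon>"
    using Y unfolding n_def by linarith+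
  have "s (K + n) \<le> r ^ n * s K"
    by (rule late_decay) (use K sK rC in auto)
  also have "\<dots> \<le> r ^ n * (r * C)"
    using sK r_pos by (intro mult_left_mono) auto
  also have "\<dots> = r ^ Suc n * C" by simp
  also have "\<dots> \<le> \<epsilon>"
    using n(1) \<epsilon> \<epsilon>C by (intro geometric_decay_le r_pos r_less_1) (simp_all only: Y_eq)
  finally have "s (K + n) \<le> \<epsilon>" .
  moreover have "real K < 1 + (\<eta>\<^sup>2 * L\<^sup>2 / \<mu> * inverse \<epsilon> + 1) * ln (\<eta>\<^sup>2 * L\<^sup>2 / (G 0)\<^sup>2)"
    using early l(2) K(1) by (intro early_length[OF \<epsilon> _ _ small]) (auto simp: k K_def)
  ultimately show ?thesis using n(2) by (intro exI[of _ "K + n"]) simp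
qed

end

section \<open>Complexity of the adaptive gradient method\<close>

lemma first_iteration_less:
  assumes "s m \<le> \<epsilon>" and "real m < b"
  shows "ereal_of_enat (first_iteration s \<epsilon>) < ereal b"
proof -
  have "first_iteration s \<epsilon> \<le> enat m"
    unfolding first_iteration_def using assms(1) by (intro INF_lower) simp
  then have "ereal_of_enat (first_iteration s \<epsilon>) \<le> ereal_of_enat (enat m)"
    by (simp only: ereal_of_enat_le_iff)
  also have "\<dots> < ereal b" using assms(2) by simp
  finally show ?thesis .
qed

theorem theorem4p7:
  fixes A :: "('m::{t2_space, second_countable_topology}, 'e::euclidean_space) chart set"
    and g :: "('m, 'e) metric"
    and f :: "'m \<Rightarrow> real"
    and L \<mu> \<eta> fstar G0 \<alpha>min :: real
    and q x0 :: 'm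
    and x :: "nat \<Rightarrow> 'm"
    and \<beta> \<alpha> :: "nat \<Rightarrow> real"
    and T :: "real \<Rightarrow> enat"
  assumes "complete_riemannian_manifold A g"
    and "differentiable_fun A f"
    and "L \<ge> 0" and "lipschitz_grad A g f L"
    and "\<And>y. f q \<le> f y" and "fstar = f q"
    and "\<mu> > 0"
    and "\<And>y. f y - fstar \<le> 1 / \<mu> * (gnorm g y (riem_grad A g f y))\<^sup>2"
    and "\<eta> > 0"
    and "riem_grad A g f x0 \<noteq> 0"
    and "madagrad A g f \<eta> x0 x \<beta> \<alpha>"
    and "G0 = gnorm g x0 (riem_grad A g f x0)"
    and "\<alpha>min = inverse (L + 2 * (f x0 - fstar) / \<eta>\<^sup>2 + \<eta>\<^sup>2 * L ^ 3 / G0\<^sup>2)"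
    and "\<And>\<epsilon>. T \<epsilon> = first_iteration (\<lambda>k. f (x k) - fstar) \<epsilon>"
  shows "\<forall>\<epsilon>>0.
    (G0 \<ge> \<eta> * L \<longrightarrow>
       ereal_of_enat (T \<epsilon>) <
         ereal (1 + \<bar>ln ((f x0 - fstar + \<eta> ^ 4 * L ^ 3 / (2 * G0\<^sup>2)) * inverse \<epsilon>)\<bar>
                      / \<bar>ln (1 - \<mu> * \<alpha>min / 2)\<bar>)) \<and>
    (\<not> G0 \<ge> \<eta> * L \<longrightarrow>
       ereal_of_enat (T \<epsilon>) <
         ereal (1 + (\<eta>\<^sup>2 * L\<^sup>2 / \<mu> * inverse \<epsilon> + 1) * ln (\<eta>\<^sup>2 * L\<^sup>2 / G0\<^sup>2)
                  + \<bar>ln ((f x0 - fstar + \<eta> ^ 4 * L ^ 3 / (2 * G0\<^sup>2)) * inverse \<epsilon>)\<bar>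
                      / \<bar>ln (1 - \<mu> * \<alpha>min / 2)\<bar>))"
proof (intro allI impI)
  fix \<epsilon> :: real assume \<epsilon>: "\<epsilon> > 0"
  interpret complete_riemannian_manifold A g by (rule assms(1))
  note f = assms(2) and L = assms(3,4)
  define s where "s k = f (x k) - fstar" for k
  define G where "G k = gnorm g (x k) (riem_grad A g f (x k))" for k
  have alg: "x 0 = x0" "\<beta> 0 = 0" "\<And>k. \<beta> (Suc k) = \<beta> k + (G k)\<^sup>2"
    "\<And>k. \<alpha> k = \<eta> / sqrt (\<beta> (Suc k))"
    "\<And>k. x (Suc k) = riem_exp A g (x k) (- \<alpha> k *\<^sub>R riem_grad A g f (x k))"
    using assms(11) unfolding madagrad_def G_def by blast+
  have min: "fstar \<le> f y" for y using assms(5,6) by simp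
  interpret adagrad_recursion s G \<beta> L \<mu> \<eta>
  proof
    show "L > 0" "(G 0)\<^sup>2 \<le> 2 * L * s 0"
      using gradient_le_gap[OF f L min assms(10)] by (simp_all add: G_def s_def alg(1))
    show "\<mu> > 0" "\<eta> > 0" by fact+
    show "\<beta> 0 = 0" "\<And>k. \<beta> (Suc k) = \<beta> k + (G k)\<^sup>2" by (fact alg)+
    show "s k \<ge> 0" for k by (simp add: s_def min)
    show "G 0 > 0" using gnorm_pos[OF assms(10)] by (simp add: G_def alg(1))
    show "s (Suc k) \<le> s k - \<eta> / sqrt (\<beta> (Suc k))
        * (1 - L * (\<eta> / sqrt (\<beta> (Suc k))) / 2) * (G k)\<^sup>2" for k
      using gradient_step[OF f L, of "x k" "\<alpha> k"] unfolding alg(5)[symmetric]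
      by (simp add: s_def G_def alg(4))
    show "\<mu> * s k \<le> (G k)\<^sup>2" for k
      using assms(8)[of "x k"] \<open>\<mu> > 0\<close> by (simp add: s_def G_def field_simps)
  qed
  have G0: "G0 = G 0" using assms(12) by (simp add: G_def alg(1))
  have C_eq: "f x0 - fstar + \<eta> ^ 4 * L ^ 3 / (2 * G0\<^sup>2) = C"
    by (simp add: C_def s_def G0 alg(1))
  have "2 * (f x0 - fstar) / \<eta>\<^sup>2 + \<eta>\<^sup>2 * L ^ 3 / G0\<^sup>2 = 2 * C / \<eta>\<^sup>2"
    using \<eta> by (simp add: C_eq[symmetric] add_divide_distrib distrib_left power2_eq_square
        power4_eq_xxxx)
  then have "\<alpha>min = \<alpha>\<^sub>m" by (simp add: assms(13) \<alpha>\<^sub>m_def add.assoc)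
  then have r_eq: "1 - \<mu> * \<alpha>min / 2 = r" by (simp add: r_def)
  have T: "T \<epsilon> = first_iteration s \<epsilon>" by (simp add: assms(14) s_def[abs_def])
  show "(G0 \<ge> \<eta> * L \<longrightarrow>
       ereal_of_enat (T \<epsilon>) <
         ereal (1 + \<bar>ln ((f x0 - fstar + \<eta> ^ 4 * L ^ 3 / (2 * G0\<^sup>2)) * inverse \<epsilon>)\<bar>
                      / \<bar>ln (1 - \<mu> * \<alpha>min / 2)\<bar>)) \<and>
    (\<not> G0 \<ge> \<eta> * L \<longrightarrow>
       ereal_of_enat (T \<epsilon>) <
         ereal (1 + (\<eta>\<^sup>2 * L\<^sup>2 / \<mu> * inverse \<epsilon> + 1) * ln (\<eta>\<^sup>2 * L\<^sup>2 / G0\<^sup>2)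
                  + \<bar>ln ((f x0 - fstar + \<eta> ^ 4 * L ^ 3 / (2 * G0\<^sup>2)) * inverse \<epsilon>)\<bar>
                      / \<bar>ln (1 - \<mu> * \<alpha>min / 2)\<bar>))"
    unfolding C_eq r_eq T
    unfolding G0 Y_def[symmetric]
    using hitting_time_large_gradient[OF \<epsilon>] hitting_time_small_gradient[OF \<epsilon>]
    by (auto simp only: not_le simp_thms intro: first_iteration_less)
qed

end
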